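(* Let $p>3$ be a prime. Then $$\sum_{k=1}^{p-1}\frac{H_k^{(2)}}{k\,16^k}\binom{2k}{k}^2\equiv-12\,\frac{H_{p-1}}{p^2}+\frac{7}{10}\,p^2B_{p-5}\pmod{p^3}$$ and $$\sum_{k=\frac{p+1}{2}}^{p-1}\frac{H_k^{(2)}}{k\,16^k}\binom{2k}{k}^2\equiv\frac{31}{2}\,p^2B_{p-5}\pmod{p^3}.$$
   Context: For positive integers $r,n$, $H_n^{(r)}=\sum_{j=1}^n j^{-r}$, with $H_0^{(r)}=0$, and $H_n=H_n^{(1)}$. The Bernoulli numbers $B_n$ are defined by $\sum_{n\ge0}B_n t^n/n!=t/(e^t-1)$. For $p$-adic integers (rationals with denominators prime to $p$) $x,y$, $x\equiv y\pmod{p^m}$ means $x-y\in p^m\mathbb{Z}_p$. (By Wolstenholme's theorem $H_{p-1}/p^2$ is $p$-integral for $p>3$.) *)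

theory Defs
  imports "HOL-Computational_Algebra.Computational_Algebra" "HOL-Number_Theory.Number_Theory"
begin

definition gharm :: "nat \<Rightarrow> nat \<Rightarrow> rat" where
  "gharm r n = (\<Sum>j=1..n. 1 / (of_nat j) ^ r)"

definition bernoulli_gf :: "rat fps" where
  "bernoulli_gf = fps_X / (fps_exp 1 - 1)"

definition bernoulli :: "nat \<Rightarrow> rat" where
  "bernoulli n = fact n * fps_nth bernoulli_gf n"

text \<open>p-adic congruence of rationals: x - y lies in p^m Z_p, i.e.
  x - y = p^m * (a/b) with b an integer not divisible by p.\<close>
definition padic_cong :: "nat \<Rightarrow> nat \<Rightarrow> rat \<Rightarrow> rat \<Rightarrow> bool" where
  "padic_cong p m x y \<longleftrightarrow>
     (\<exists>a b :: int. b \<noteq> 0 \<and> \<not> (int p dvd b) \<and> x - y = of_nat (p ^ m) * (of_int a / of_int b))"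

end

theory Submission
  imports Defs
begin

text \<open>
  Write \<open>p = 2n + 1\<close> and deform the sums: with
  \<open>F\<^sub>K(x) = \<Sum>k=1..K. H\<^sub>k\<^sup>(\<^sup>2\<^sup>) / (k k!\<^sup>2) \<cdot> \<Prod>j=1..k. ((j - 1/2)\<^sup>2 - x\<^sup>2)\<close>
  the sum up to \<open>K\<close> is \<open>F\<^sub>K(0)\<close>. Put \<open>P\<^sub>K(x) = \<Prod>j=1..K. (1 - x\<^sup>2/j\<^sup>2)\<close>. The central difference of \<open>F\<^sub>K\<close>
  has a closed form: \<open>x\<^sup>3\<close> times it equals \<open>2 (x\<^sup>2 H\<^sub>K\<^sup>(\<^sup>2\<^sup>) P\<^sub>K(x) + P\<^sub>K(x) - 1)\<close>.
  It telescopes on half-integers to \<open>F\<^sub>n(p/2) = -2 H\<^sub>n\<^sup>(\<^sup>3\<^sup>)\<close>, and since \<open>F\<^sub>n\<close> is even, \<open>F\<^sub>n(0)\<close> differs from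
  this modulo \<open>p\<^sup>3\<close> only by \<open>p\<^sup>2/4\<close> times the \<open>x\<^sup>2\<close>-coefficient of \<open>F\<^sub>n\<close>.

  Modulo \<open>p\<close> one has \<open>P\<^sub>n \<equiv> 1 - x\<^bsup>p-1\<^esup>\<close>, so the central difference of \<open>F\<^sub>n\<close> is \<open>-2 x\<^bsup>p-4\<^esup>\<close>; comparison with a
  Bernoulli polynomial gives the \<open>x\<^sup>2\<close>-coefficient \<open>124 B\<^bsub>p-5\<^esub>\<close>. For the upper half,
  \<open>F\<^bsub>p-1\<^esub> - F\<^sub>n = (p\<^sup>2/4 - x\<^sup>2) E R\<close> where \<open>E\<close> is the product over \<open>j \<le> n\<close> and \<open>x E \<equiv> E(0) (x - x\<^sup>p)\<close>. As \<open>x\<^sup>p - x\<close> is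
  invariant under shifts, it cancels, and the central difference of \<open>E(0) x R\<close> is \<open>2 x\<^bsup>p-5\<^esup>\<close>, whence
  \<open>E(0) R(0) \<equiv> 62 B\<^bsub>p-5\<^esub>\<close>. Finally \<open>H\<^sub>n\<^sup>(\<^sup>3\<^sup>)\<close> is expressed by \<open>H\<^bsub>p-1\<^esub>/p\<^sup>2\<close> by expanding \<open>\<Sum>j<p. 1/j\<^sup>r\<close> (\<open>r = 1, 3\<close>) along
  the two pairings \<open>{j, p - j}\<close> and \<open>{2j, p - 2j}\<close>; this divides by 5, so \<open>p = 5\<close> is computed directly.
\<close>

hide_const (open) up_ring.coeff up_ring.monom module.smult

section \<open>Congruences of rationals and of rational polynomials\<close>

text \<open>The ideal \<open>p^m Z_(p)\<close> as a set, so that congruences become memberships with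
  closure rules.\<close>

definition pideal :: "nat \<Rightarrow> nat \<Rightarrow> rat set" where
  "pideal p m = {x. padic_cong p m x 0}"

lemma padic_cong_iff: "padic_cong p m x y \<longleftrightarrow> x - y \<in> pideal p m"
  by (simp add: pideal_def padic_cong_def)

locale prime_gt3 =
  fixes p n :: nat
  assumes prime: "prime p" and gt3: "p > 3" and p_eq: "p = 2 * n + 1"
begin

abbreviation I :: "nat \<Rightarrow> rat set" where "I \<equiv> pideal p"

lemma in_I: fixes x :: rat shows "x \<in> I m \<longleftrightarrow> (\<exists>a b :: int. \<not> int p dvd b \<and> x = of_nat (p ^ m) * (of_int a / of_int b))"
proof -
  have "b \<noteq> 0 \<and> \<not> int p dvd b \<longleftrightarrow> \<not> int p dvd b" for b by auto
  then show ?thesis unfolding pideal_def padic_cong_def mem_Collect_eq diff_0_right by metis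
qed

lemma I_mult: assumes "x \<in> I k" "y \<in> I m" shows "x * y \<in> I (k + m)"
proof -
  obtain a b c d :: int where *: "\<not> int p dvd b" "x = of_nat (p ^ k) * (of_int a / of_int b)"
    "\<not> int p dvd d" "y = of_nat (p ^ m) * (of_int c / of_int d)"
    using assms unfolding in_I by blast
  have "\<not> int p dvd b * d" using * prime by (simp add: prime_dvd_mult_iff)
  moreover have "x * y = of_nat (p ^ (k + m)) * (of_int (a * c) / of_int (b * d))"
    using * by (simp add: power_add)
  ultimately show ?thesis unfolding in_I by blast
qed

lemma I_add [intro]: assumes "x \<in> I m" "y \<in> I m" shows "x + y \<in> I m"
proof -
  obtain a b c d :: int where *: "\<not> int p dvd b" "x = of_nat (p ^ m) * (of_int a / of_int b)"
    "\<not> int p dvd d" "y = of_nat (p ^ m) * (of_int c / of_int d)"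
    using assms unfolding in_I by blast
  have "\<not> int p dvd b * d" using * prime by (simp add: prime_dvd_mult_iff)
  moreover have "x + y = of_nat (p ^ m) * (of_int (a * d + c * b) / of_int (b * d))"
  proof -
    have "b \<noteq> 0" "d \<noteq> 0" using * by auto
    then show ?thesis using *(2,4) by (simp add: field_simps)
  qed
  ultimately show ?thesis unfolding in_I by blast
qed

lemma p_not_dvd_1: "\<not> int p dvd 1"
  using gt3 by simp

lemma I_frac: "\<not> int p dvd b \<Longrightarrow> of_int a / of_int b \<in> I 0"
  unfolding in_I by auto

lemma I_of_int [intro, simp]: "of_int a \<in> I 0"
  using I_frac[of 1 a] p_not_dvd_1 by simp

lemma I_of_nat [intro, simp]: "of_nat a \<in> I 0"
  using I_of_int[of "int a"] by simp

lemma I_numeral [intro, simp]: "numeral w \<in> I 0" "1 \<in> I 0"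
  using I_of_int[of "numeral w"] I_of_int[of 1] by simp_all

lemma I_p_power [intro, simp]: "of_nat p ^ m \<in> I m"
  unfolding in_I using p_not_dvd_1 by (intro exI[of _ 1]) simp

lemma I_p [intro, simp]: "of_nat p \<in> I 1" "of_nat p \<in> I (Suc 0)"
  using I_p_power[of 1] by simp_all

lemma I_mult0 [intro]: "x \<in> I 0 \<Longrightarrow> y \<in> I m \<Longrightarrow> x * y \<in> I m"
  using I_mult[of x 0 y m] by simp

lemma I_mult0': "x \<in> I m \<Longrightarrow> y \<in> I 0 \<Longrightarrow> x * y \<in> I m"
  using I_mult[of x m y 0] by simp

lemma I_zero [intro, simp]: "0 \<in> I m"
  unfolding in_I using p_not_dvd_1 by (intro exI[of _ 0] exI[of _ 1]) simp

lemma I_minus [intro]: "x \<in> I m \<Longrightarrow> - x \<in> I m"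
  using I_mult0[of "-1" x m] I_of_int[of "-1"] by simp

lemma I_diff [intro]: "x \<in> I m \<Longrightarrow> y \<in> I m \<Longrightarrow> x - y \<in> I m"
  using I_add[of x m "-y"] by auto

lemma I_mono: "k \<le> m \<Longrightarrow> x \<in> I m \<Longrightarrow> x \<in> I k"
  unfolding in_I
proof (elim exE conjE)
  fix a b :: int assume "k \<le> m" "\<not> int p dvd b" "x = of_nat (p ^ m) * (of_int a / of_int b)"
  then have "x = of_nat (p ^ k) * (of_int (int (p ^ (m - k)) * a) / of_int b)"
    by (simp flip: power_add mult.assoc)
  with \<open>\<not> int p dvd b\<close> show "\<exists>a b :: int. \<not> int p dvd b \<and> x = of_nat (p ^ k) * (of_int a / of_int b)"
    by blast
qed

lemma I_sum [intro]: "(\<And>i. i \<in> A \<Longrightarrow> f i \<in> I m) \<Longrightarrow> sum f A \<in> I m"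
  by (induction A rule: infinite_finite_induct) auto

lemma I_prod [intro]: "(\<And>i. i \<in> A \<Longrightarrow> f i \<in> I 0) \<Longrightarrow> prod f A \<in> I 0"
  by (induction A rule: infinite_finite_induct) auto

lemma I_power: "x \<in> I 0 \<Longrightarrow> x ^ m \<in> I 0"
  by (induction m) auto

lemma I_power1: "x \<in> I 1 \<Longrightarrow> x ^ m \<in> I m"
  using I_mult[of x 1] by (induction m) simp_all

lemma I_p_div: assumes "of_nat p ^ k * x \<in> I (k + m)" shows "x \<in> I m"
proof -
  obtain a b :: int where *: "\<not> int p dvd b" "of_nat p ^ k * x = of_nat (p ^ (k + m)) * (of_int a / of_int b)"
    using assms unfolding in_I by blast
  have "(of_nat p :: rat) ^ k \<noteq> 0" using gt3 by simp
  then have "x = of_nat (p ^ m) * (of_int a / of_int b)"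
    using *(2) mult_left_cancel[of "of_nat p ^ k" x "of_nat (p ^ m) * (of_int a / of_int b)"]
    by (simp add: power_add mult.assoc)
  with * show ?thesis unfolding in_I by blast
qed

section \<open>Units of the ring of \<open>p\<close>-integral rationals\<close>

definition unit :: "rat \<Rightarrow> bool" where
  "unit x \<longleftrightarrow> x \<noteq> 0 \<and> x \<in> I 0 \<and> inverse x \<in> I 0"

lemma unit_I: "unit x \<Longrightarrow> x \<in> I 0" and unit_nonzero: "unit x \<Longrightarrow> x \<noteq> 0"
  and unit_inverse: "unit x \<Longrightarrow> inverse x \<in> I 0"
  by (auto simp: unit_def)

lemma unit_of_int: assumes "\<not> int p dvd a" shows "unit (of_int a)"
proof -
  have "inverse (of_int a :: rat) \<in> I 0" using I_frac[OF assms, of 1] by (simp add: inverse_eq_divide)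
  moreover have "a \<noteq> 0" using assms by auto
  ultimately show ?thesis by (simp add: unit_def)
qed

lemma unit_of_nat: "\<not> p dvd a \<Longrightarrow> unit (of_nat a)"
  using unit_of_int[of "int a"] by (simp add: int_dvd_int_iff)

lemma unit_mult: "unit x \<Longrightarrow> unit y \<Longrightarrow> unit (x * y)"
  by (auto simp: unit_def)

lemma unit_div: "unit x \<Longrightarrow> unit y \<Longrightarrow> unit (x / y)"
  by (auto simp: unit_def divide_inverse)

lemma unit_power: "unit x \<Longrightarrow> unit (x ^ m)"
  by (induction m) (auto intro: unit_mult simp: unit_def)

lemma unit_small: "0 < a \<Longrightarrow> a < p \<Longrightarrow> unit (of_nat a)"
  by (rule unit_of_nat) (auto dest: dvd_imp_le)

lemma unit_2: "unit 2" and unit_4: "unit 4" and unit_3: "unit 3"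
proof -
  show 2: "unit 2" using unit_small[of 2] gt3 by simp
  show "unit 3" using unit_small[of 3] gt3 by simp
  show "unit 4" using unit_power[OF 2, of 2] by simp
qed

lemma unit_fact: "k < p \<Longrightarrow> unit (fact k)"
  using unit_of_nat[of "fact k"] prime by (simp add: prime_dvd_fact_iff)

lemma I_divide: "x \<in> I m \<Longrightarrow> unit y \<Longrightarrow> x / y \<in> I m"
  unfolding divide_inverse by (rule I_mult0') (auto dest: unit_inverse)

lemma unit_cancel: "unit y \<Longrightarrow> y * x \<in> I m \<Longrightarrow> x \<in> I m"
  using I_divide[of "y * x" m y] by (auto simp: unit_def)

lemma half_I [simp, intro]: "1 / 2 \<in> I 0"
  using unit_inverse[OF unit_2] by (simp add: inverse_eq_divide)

lemma I_half: "x \<in> I m \<Longrightarrow> x / 2 \<in> I m"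
  by (rule I_divide[OF _ unit_2])

lemma p_not_dvd_2: "\<not> p dvd 2"
  using gt3 by (auto dest: dvd_imp_le)

lemma fermat: assumes "\<not> p dvd a" shows "of_nat a ^ (p - 1) - (1::rat) \<in> I 1"
proof -
  have "[a ^ (p - 1) = 1] (mod p)" using assms fermat_theorem[OF prime] by blast
  then have "[int a ^ (p - 1) = 1] (mod int p)"
    by (metis cong_int_iff of_nat_1 of_nat_power)
  then obtain c where "int a ^ (p - 1) - 1 = int p * c"
    by (auto simp: cong_iff_dvd_diff)
  then have "(of_int (int a ^ (p - 1) - 1) :: rat) = of_nat p * of_int c" by simp
  then show ?thesis using I_mult0'[OF I_p(1), of "of_int c"] by simp
qed

section \<open>Polynomials with \<open>p\<close>-integral coefficients\<close>

definition IP :: "nat \<Rightarrow> rat poly set" where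
  "IP m = {f. \<forall>i. coeff f i \<in> I m}"

lemma IP_coeff: "f \<in> IP m \<Longrightarrow> coeff f i \<in> I m"
  by (simp add: IP_def)

lemma IP_add [intro]: "f \<in> IP m \<Longrightarrow> g \<in> IP m \<Longrightarrow> f + g \<in> IP m"
  and IP_diff [intro]: "f \<in> IP m \<Longrightarrow> g \<in> IP m \<Longrightarrow> f - g \<in> IP m"
  and IP_minus [intro]: "f \<in> IP m \<Longrightarrow> - f \<in> IP m"
  and IP_zero [intro, simp]: "0 \<in> IP m"
  and IP_smult [intro]: "c \<in> I 0 \<Longrightarrow> f \<in> IP m \<Longrightarrow> smult c f \<in> IP m"
  by (auto simp: IP_def)

lemma IP_smult': "c \<in> I m \<Longrightarrow> f \<in> IP 0 \<Longrightarrow> smult c f \<in> IP m"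
  by (auto simp: IP_def intro: I_mult0')

lemma IP_mult [intro]: "f \<in> IP 0 \<Longrightarrow> g \<in> IP m \<Longrightarrow> f * g \<in> IP m"
  by (auto simp: IP_def coeff_mult)

lemma IP_mult': "f \<in> IP m \<Longrightarrow> g \<in> IP 0 \<Longrightarrow> f * g \<in> IP m"
  using IP_mult[of g f m] by (simp add: mult.commute)

lemma IP_sum [intro]: "(\<And>i. i \<in> A \<Longrightarrow> f i \<in> IP m) \<Longrightarrow> sum f A \<in> IP m"
  by (induction A rule: infinite_finite_induct) auto

lemma IP_pCons: "pCons a f \<in> IP m \<longleftrightarrow> a \<in> I m \<and> f \<in> IP m"
  by (auto simp: IP_def coeff_pCons split: nat.splits)

lemma IP_one [simp, intro]: "1 \<in> IP 0"
  by (simp add: IP_def)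

lemma IP_prod [intro]: "(\<And>i. i \<in> A \<Longrightarrow> f i \<in> IP 0) \<Longrightarrow> prod f A \<in> IP 0"
  by (induction A rule: infinite_finite_induct) auto

lemma IP_monom: "c \<in> I m \<Longrightarrow> monom c k \<in> IP m"
  by (auto simp: IP_def)

lemma IP_pcompose: "f \<in> IP m \<Longrightarrow> g \<in> IP 0 \<Longrightarrow> pcompose f g \<in> IP m"
  by (induction f) (auto simp: pcompose_pCons IP_pCons)

lemma IP_poly: "f \<in> IP m \<Longrightarrow> x \<in> I 0 \<Longrightarrow> poly f x \<in> I m"
  by (induction f) (auto simp: IP_pCons)

lemma IP_synthetic_div: "f \<in> IP 0 \<Longrightarrow> a \<in> I 0 \<Longrightarrow> synthetic_div f a \<in> IP 0"
  by (induction f) (auto simp: IP_pCons intro: IP_poly)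

text \<open>Splitting off \<open>x - a\<close> leaves a quotient that vanishes modulo
  \<open>p\<close> at the remaining points, because differences of points are units. This turns
  congruences of values into congruences of coefficients.\<close>

lemma lagrange:
  assumes "finite S" "f \<in> IP 0" "degree f < card S" "S \<subseteq> I 0"
    "\<And>x y. x \<in> S \<Longrightarrow> y \<in> S \<Longrightarrow> x \<noteq> y \<Longrightarrow> unit (x - y)"
    "\<And>x. x \<in> S \<Longrightarrow> poly f x \<in> I 1"
  shows "f \<in> IP 1"
  using assms
proof (induction S arbitrary: f rule: finite_induct)
  case empty
  then show ?case by simp
next
  case (insert a S)
  define q where "q = synthetic_div f a"
  have f: "f = [:-a, 1:] * q + [:poly f a:]"
    unfolding q_def by (rule synthetic_div_correct'[symmetric])
  have a: "[:poly f a:] \<in> IP 1" using insert.prems by (auto simp: IP_pCons)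
  show ?case
  proof (cases "degree f = 0")
    case True
    then show ?thesis using a by (metis degree_eq_zeroE poly_const_conv)
  next
    case False
    have q0: "q \<in> IP 0" unfolding q_def using insert.prems by (auto intro: IP_synthetic_div)
    have "q \<in> IP 1"
    proof (rule insert.IH)
      show "degree q < card S"
        using insert.prems(2) insert.hyps False by (simp add: q_def degree_synthetic_div)
      fix x assume x: "x \<in> S"
      have "(x - a) * poly q x = poly f x - poly f a"
        using arg_cong[OF f, of "\<lambda>g. poly g x"] by (simp add: algebra_simps)
      then have "(x - a) * poly q x \<in> I 1" using insert.prems x by auto
      moreover have "unit (x - a)" using insert.prems x insert.hyps by auto
      ultimately show "poly q x \<in> I 1" using unit_cancel by blast
    qed (use insert.prems q0 in auto)
    moreover have "[:-a, 1:] \<in> IP 0" using insert.prems by (auto simp: IP_pCons)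
    ultimately have "[:-a, 1:] * q + [:poly f a:] \<in> IP 1" using a by (intro IP_add IP_mult)
    then show ?thesis by (simp only: f[symmetric])
  qed
qed

end

section \<open>Central Bernoulli polynomials\<close>

text \<open>Division of power series is a true quotient only under divisibility, which holds since
  numerator and denominator both have subdegree 1.\<close>

lemma bernoulli_gf_mult: "bernoulli_gf * (fps_exp 1 - 1) = fps_X"
proof -
  have "subdegree (fps_exp 1 - 1 :: rat fps) = 1"
    by (rule subdegreeI) auto
  moreover have "subdegree (fps_X :: rat fps) = 1" by simp
  moreover have "fps_exp 1 - 1 \<noteq> (0 :: rat fps)" using calculation(1) by (metis subdegree_0 zero_neq_one)
  ultimately have "(fps_exp 1 - 1 :: rat fps) dvd fps_X"
    by (subst fps_dvd_iff) auto
  then show ?thesis unfolding bernoulli_gf_def by (rule dvd_div_mult_self)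
qed

text \<open>This is \<open>t / (2 sinh (t/2))\<close>, whose coefficients are \<open>B\<^sub>i(1/2) / i! = (2\<^bsup>1-i\<^esup> - 1) B\<^sub>i / i!\<close>.\<close>
definition central_gf :: "rat fps" where
  "central_gf = Abs_fps (\<lambda>i. (2 / 2 ^ i - 1) * fps_nth bernoulli_gf i)"

lemma central_gf_eq: "central_gf = 2 * (bernoulli_gf oo (fps_const (1 / 2) * fps_X)) - bernoulli_gf"
  unfolding central_gf_def fps_compose_linear
  by (simp add: fps_eq_iff field_simps numeral_fps_const)

text \<open>With \<open>s = e^(t/2)\<close> the series is
  \<open>t/(s - 1) - t/(s^2 - 1) = t s/(s^2 - 1)\<close>; both identities follow from this.\<close>

lemma central_gf_exp: "central_gf * fps_exp (1 / 2) = bernoulli_gf + fps_X"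
  and central_gf_mult: "central_gf * (fps_exp (1 / 2) - fps_exp (- 1 / 2)) = fps_X"
proof -
  define s :: "rat fps" where "s = fps_exp (1 / 2)"
  define B :: "rat fps" where "B = bernoulli_gf oo (fps_const (1 / 2) * fps_X)"
  define h :: "rat fps" where "h = fps_const (1 / 2)"
  have h: "2 * h = 1" by (simp add: h_def numeral_fps_const)
  have ss: "s * s = fps_exp 1" by (simp add: s_def flip: fps_exp_add_mult)
  have s1: "s * fps_exp (- 1 / 2) = 1" by (simp add: s_def flip: fps_exp_add_mult)
  have z: "fps_nth (fps_const (1 / 2 :: rat) * fps_X) 0 = 0" by simp
  have "(fps_exp 1 oo (fps_const (1 / 2) * fps_X)) = s"
    unfolding fps_compose_linear by (simp add: s_def fps_eq_iff)
  then have B: "B * (s - 1) = h * fps_X"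
    using arg_cong[OF bernoulli_gf_mult, of "\<lambda>f. f oo (fps_const (1 / 2) * fps_X)"] z
    by (simp add: B_def h_def fps_compose_mult_distrib fps_compose_sub_distrib)
  have C: "central_gf = 2 * B - bernoulli_gf" by (simp add: central_gf_eq B_def)
  have D: "bernoulli_gf * (s * s - 1) = fps_X" using bernoulli_gf_mult by (simp add: ss)
  have s_nz: "s \<noteq> 0" "s - 1 \<noteq> 0"
  proof -
    have "fps_nth s 1 \<noteq> 0" "fps_nth (s - 1) 1 \<noteq> 0" by (simp_all add: s_def)
    then show "s \<noteq> 0" "s - 1 \<noteq> 0" by (metis fps_zero_nth)+
  qed
  have E: "central_gf * (s * s - 1) = fps_X * s"
  proof -
    have "central_gf * (s * s - 1) = 2 * (B * (s - 1)) * (s + 1) - bernoulli_gf * (s * s - 1)"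
      unfolding C by (simp add: algebra_simps)
    also have "\<dots> = (2 * h) * fps_X * (s + 1) - fps_X" unfolding B D by (simp add: algebra_simps)
    also have "\<dots> = fps_X * s" unfolding h by (simp add: algebra_simps)
    finally show ?thesis .
  qed
  have "s * (central_gf * (s - fps_exp (- 1 / 2))) = central_gf * (s * s - s * fps_exp (- 1 / 2))"
    by (simp add: algebra_simps)
  also have "\<dots> = s * fps_X" unfolding s1 E by (simp add: mult.commute)
  finally show "central_gf * (fps_exp (1 / 2) - fps_exp (- 1 / 2)) = fps_X"
    using s_nz unfolding s_def by simp
  have "(s * s - 1) * (central_gf * s) = (s * s - 1) * (bernoulli_gf + fps_X)"
  proof -
    have "(s * s - 1) * (central_gf * s) = fps_X * s * s" using E by (simp add: algebra_simps)
    also have "\<dots> = bernoulli_gf * (s * s - 1) + (s * s - 1) * fps_X"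
      unfolding D by (simp add: algebra_simps)
    finally show ?thesis by (simp add: algebra_simps)
  qed
  moreover have "s * s - 1 \<noteq> 0" using D by auto
  ultimately show "central_gf * fps_exp (1 / 2) = bernoulli_gf + fps_X"
    unfolding s_def by simp
qed

text \<open>This is \<open>B_m(x + 1/2)\<close> for the Bernoulli polynomial \<open>B_m\<close>,
  recentred so that central differences are monomials.\<close>

definition central_bernpoly :: "nat \<Rightarrow> rat poly" where
  "central_bernpoly m = (\<Sum>i\<le>m. monom (fact m / fact (m - i) * fps_nth central_gf i) (m - i))"

lemma poly_central_bernpoly: "poly (central_bernpoly m) x = fact m * fps_nth (central_gf * fps_exp x) m"
  unfolding central_bernpoly_def fps_mult_nth poly_sum poly_monom sum_distrib_left atMost_atLeast0
  by (intro sum.cong) simp_all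

text \<open>On generating functions the central difference multiplies by
  \<open>e^(t/2) - e^(-t/2)\<close>, which cancels the denominator of \<open>central_gf\<close> and
  leaves \<open>t e^(xt)\<close>.\<close>

lemma central_bernpoly_diff:
  "poly (central_bernpoly (Suc m)) (x + 1 / 2) - poly (central_bernpoly (Suc m)) (x - 1 / 2) = of_nat (Suc m) * x ^ m"
proof -
  have "central_gf * fps_exp (x + 1 / 2) - central_gf * fps_exp (x - 1 / 2)
      = central_gf * (fps_exp (1 / 2) - fps_exp (- 1 / 2)) * fps_exp x"
    using fps_exp_add_mult[of x "1 / 2"] fps_exp_add_mult[of x "- 1 / 2"]
    by (simp add: algebra_simps)
  then have "central_gf * fps_exp (x + 1 / 2) - central_gf * fps_exp (x - 1 / 2) = fps_X * fps_exp x"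
    unfolding central_gf_mult .
  from arg_cong[OF this, of "\<lambda>f. fact (Suc m) * fps_nth f (Suc m)"]
  show ?thesis unfolding poly_central_bernpoly by (simp add: right_diff_distrib)
qed

lemma coeff_central_bernpoly:
  "j \<le> m \<Longrightarrow> coeff (central_bernpoly m) j = fact m / fact j * fps_nth central_gf (m - j)"
proof -
  assume j: "j \<le> m"
  have "coeff (central_bernpoly m) j =
    (\<Sum>i\<le>m. if i = m - j then fact m / fact j * fps_nth central_gf (m - j) else 0)"
    unfolding central_bernpoly_def coeff_sum using j by (intro sum.cong) auto
  then show ?thesis by simp
qed

lemma degree_central_bernpoly: "degree (central_bernpoly m) \<le> m"
  unfolding central_bernpoly_def by (intro degree_sum_le) (auto intro: order_trans[OF degree_monom_le])

section \<open>Bernoulli coefficients modulo \<open>p\<close>\<close>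

context prime_gt3 begin

lemma fact_I [simp, intro]: "fact k \<in> I 0"
  using I_of_nat[of "fact k"] by simp

lemma p_ge_5: "p \<ge> 5"
  using gt3 p_eq by presburger

text \<open>The coefficient of \<open>t^(m+1)\<close> in \<open>bernoulli_gf_mult\<close> gives a
  recurrence whose denominators are factorials of numbers below \<open>p\<close>.\<close>

lemma bernoulli_gf_I: "i \<le> p - 2 \<Longrightarrow> fps_nth bernoulli_gf i \<in> I 0"
proof (induction i rule: less_induct)
  case (less m)
  have "fps_nth (bernoulli_gf * (fps_exp 1 - 1)) (Suc m) = fps_nth (fps_X :: rat fps) (Suc m)"
    by (simp only: bernoulli_gf_mult)
  then have "(\<Sum>i=0..Suc m. fps_nth bernoulli_gf i * fps_nth (fps_exp 1 - 1) (Suc m - i)) = (if m = 0 then 1 else 0)"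
    by (simp only: fps_mult_nth fps_X_nth) simp
  moreover have "(\<Sum>i=0..Suc m. fps_nth bernoulli_gf i * fps_nth (fps_exp 1 - 1) (Suc m - i))
      = (\<Sum>i=0..m. fps_nth bernoulli_gf i / fact (Suc m - i))"
    unfolding sum.atLeast0_atMost_Suc by (auto intro!: sum.cong)
  moreover have "\<dots> = (\<Sum>i<m. fps_nth bernoulli_gf i / fact (Suc m - i)) + fps_nth bernoulli_gf m"
    by (simp add: atLeast0AtMost flip: lessThan_Suc_atMost)
  ultimately have "fps_nth bernoulli_gf m = (if m = 0 then 1 else 0) - (\<Sum>i<m. fps_nth bernoulli_gf i / fact (Suc m - i))"
    by linarith
  also have "\<dots> \<in> I 0"
    by (intro I_diff I_sum I_divide unit_fact less.IH) (use less.prems gt3 in auto)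
  finally show ?case .
qed

lemma central_gf_I: "i \<le> p - 2 \<Longrightarrow> fps_nth central_gf i \<in> I 0"
  by (auto simp: central_gf_def intro!: I_mult0 I_diff I_divide unit_power unit_2 bernoulli_gf_I)

lemma central_bernpoly_IP: "m \<le> p - 2 \<Longrightarrow> central_bernpoly m \<in> IP 0"
  unfolding central_bernpoly_def
  by (intro IP_sum IP_monom I_mult0 central_gf_I I_divide unit_fact)
    (use gt3 in auto)

text \<open>Fermat turns \<open>2/2^(p-5) - 1 = 32/2^(p-1) - 1\<close> into 31.\<close>

lemma central_gf_cong: "fact (p - 5) * fps_nth central_gf (p - 5) - 31 * bernoulli (p - 5) \<in> I 1"
proof -
  have "(2::rat) / 2 ^ (p - 5) = 32 / 2 ^ (p - 1)"
  proof -
    have "p - 1 = p - 5 + 4" using p_ge_5 by simp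
    then have "(2::rat) ^ (p - 1) = 2 ^ (p - 5) * 16" by (simp only: power_add) simp
    then show ?thesis by (simp add: field_simps)
  qed
  then have "fact (p - 5) * fps_nth central_gf (p - 5) - 31 * bernoulli (p - 5)
     = 32 * ((1 - 2 ^ (p - 1)) / 2 ^ (p - 1)) * bernoulli (p - 5)"
    unfolding central_gf_def bernoulli_def by (simp add: field_simps)
  also have "\<dots> \<in> I 1"
  proof (rule I_mult0'[OF I_mult0[OF _ I_divide[OF _ unit_power[OF unit_2]]]])
    show "1 - 2 ^ (p - 1) \<in> I 1" using I_minus[OF fermat[OF p_not_dvd_2]] by simp
    show "bernoulli (p - 5) \<in> I 0" unfolding bernoulli_def
      by (intro I_mult0 bernoulli_gf_I) auto
  qed auto
  finally show ?thesis .
qed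

end

section \<open>Harmonic sums\<close>

lemma sum_even_powers: "(\<Sum>j=1..k. 1 / of_nat (2 * j) ^ r :: rat) = gharm r k / 2 ^ r"
  unfolding gharm_def sum_divide_distrib by (intro sum.cong) (auto simp: power_mult_distrib)

text \<open>Geometric expansion of \<open>1/(q - a)\<close> in powers of \<open>q/a\<close> with its
  exact remainder. The inverses enter through equations, which makes this a polynomial ideal
  membership.\<close>

lemma reciprocal_expand1:
  fixes a :: rat
  assumes "a * u = 1" "(q - a) * v = 1"
  shows "u + v + (q * u ^ 2 + q ^ 2 * u ^ 3 + q ^ 3 * u ^ 4 + q ^ 4 * u ^ 5) = q ^ 5 * (u ^ 5 * v)"
  using assms by Groebner_Basis.algebra

text \<open>The analogue for cubes, from
  \<open>(1 - q/a)^(-3) = 1 + 3 q/a + 6 q^2/a^2 + ...\<close>.\<close>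

lemma reciprocal_expand3:
  fixes a :: rat
  assumes "a * u = 1" "(q - a) * v = 1"
  shows "u ^ 3 + v ^ 3 + (3 * q * u ^ 4 + 6 * q ^ 2 * u ^ 5)
    = q ^ 3 * (10 * (a * a) - 15 * (q * a) + 6 * (q * q)) * (u ^ 5 * v ^ 3)"
  using assms by Groebner_Basis.algebra

section \<open>Two pairings of the residues and the relations they yield\<close>

context prime_gt3 begin

lemma sum_reflect:
  fixes F :: "nat \<Rightarrow> rat"
  shows "(\<Sum>j=1..p-1. F j) = (\<Sum>j=1..n. F j + F (p - j))"
proof -
  have "{1..p-1} = {1..n} \<union> {n+1..p-1}" using p_eq by auto
  then have "(\<Sum>j=1..p-1. F j) = (\<Sum>j=1..n. F j) + (\<Sum>j=n+1..p-1. F j)"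
    by (simp add: sum.union_disjoint)
  also have "(\<Sum>j=n+1..p-1. F j) = (\<Sum>j=1..n. F (p - j))"
    by (rule sum.reindex_bij_witness[of _ "\<lambda>j. p - j" "\<lambda>j. p - j"]) (use p_eq in auto)
  finally show ?thesis by (simp add: sum.distrib)
qed

text \<open>As \<open>p\<close> is odd, the odd numbers below it are the \<open>p - 2j\<close>; this
  is the pairing \<open>{2j, p - 2j}\<close>.\<close>

lemma sum_parity:
  fixes F :: "nat \<Rightarrow> rat"
  shows "(\<Sum>j=1..p-1. F j) = (\<Sum>j=1..n. F (2 * j) + F (p - 2 * j))"
proof -
  have "(\<Sum>j=1..2*m. F j) = (\<Sum>j=1..m. F (2 * j)) + (\<Sum>j=1..m. F (2 * j - 1))" for m
    by (induction m) (auto simp: algebra_simps)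
  then have "(\<Sum>j=1..p-1. F j) = (\<Sum>j=1..n. F (2 * j)) + (\<Sum>j=1..n. F (2 * j - 1))"
    using p_eq by simp
  also have "(\<Sum>j=1..n. F (2 * j - 1)) = (\<Sum>j=1..n. F (p - 2 * j))"
    by (rule sum.reindex_bij_witness[of _ "\<lambda>j. n + 1 - j" "\<lambda>j. n + 1 - j"])
      (use p_eq in \<open>auto simp: algebra_simps intro!: arg_cong[of _ _ F]\<close>)
  finally show ?thesis by (simp add: sum.distrib)
qed

text \<open>The precision \<open>p^5\<close> is what \<open>H_(p-1)/p^2\<close> modulo
  \<open>p^3\<close> requires.\<close>

lemma expand1:
  assumes "unit a" "unit (of_nat p - a)"
  shows "1 / a + 1 / (of_nat p - a) + (of_nat p * (1 / a ^ 2) + of_nat p ^ 2 * (1 / a ^ 3)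
    + of_nat p ^ 3 * (1 / a ^ 4) + of_nat p ^ 4 * (1 / a ^ 5)) \<in> I 5" (is "?l \<in> _")
proof -
  define q where "q = (of_nat p :: rat)"
  have nz: "a \<noteq> 0" "q - a \<noteq> 0" using assms by (auto simp: unit_def q_def)
  have "?l = q ^ 5 / (a ^ 5 * (q - a))"
  proof -
    have "a * (1 / a) = 1" "(q - a) * (1 / (q - a)) = 1" using nz by simp_all
    note reciprocal_expand1[OF this]
    then show ?thesis by (simp only: q_def power_one_over times_divide_eq_right mult_1_right divide_divide_eq_left times_divide_times_eq)
  qed
  also have "\<dots> \<in> I 5" unfolding q_def
    by (intro I_divide unit_mult unit_power assms I_p_power)
  finally show ?thesis .
qed

lemma expand3:
  assumes "unit a" "unit (of_nat p - a)"
  shows "1 / a ^ 3 + 1 / (of_nat p - a) ^ 3 + (3 * of_nat p * (1 / a ^ 4) + 6 * of_nat p ^ 2 * (1 / a ^ 5)) \<in> I 3" (is "?l \<in> _")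
proof -
  define q where "q = (of_nat p :: rat)"
  have nz: "a \<noteq> 0" "q - a \<noteq> 0" using assms by (auto simp: unit_def q_def)
  have "?l = q ^ 3 * (10 * (a * a) - 15 * (q * a) + 6 * (q * q)) / (a ^ 5 * (q - a) ^ 3)"
  proof -
    have "a * (1 / a) = 1" "(q - a) * (1 / (q - a)) = 1" using nz by simp_all
    note reciprocal_expand3[OF this]
    then show ?thesis by (simp only: q_def power_one_over times_divide_eq_right mult_1_right divide_divide_eq_left times_divide_times_eq)
  qed
  also have "\<dots> \<in> I 3" unfolding q_def
    by (intro I_divide unit_mult unit_power assms I_mult0'[OF I_p_power] I_add I_diff I_mult0[of _ _ 0])
      (use assms in \<open>auto intro: unit_I\<close>)
  finally show ?thesis .
qed

lemma unit_index: "j \<in> {1..n} \<Longrightarrow> unit (of_nat j)" "j \<in> {1..n} \<Longrightarrow> unit (of_nat p - of_nat j)"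
  "j \<in> {1..n} \<Longrightarrow> unit (of_nat (2 * j))" "j \<in> {1..n} \<Longrightarrow> unit (of_nat p - of_nat (2 * j))"
  using unit_small[of j] unit_small[of "p - j"] unit_small[of "2 * j"] unit_small[of "p - 2 * j"] p_eq
  by (auto simp: of_nat_diff)

lemma gharm1_full1: "gharm 1 (p - 1) + (of_nat p * gharm 2 n + of_nat p ^ 2 * gharm 3 n
    + of_nat p ^ 3 * gharm 4 n + of_nat p ^ 4 * gharm 5 n) \<in> I 5"
proof -
  have "(\<Sum>j=1..n. 1 / of_nat j + 1 / (of_nat p - of_nat j) + (of_nat p * (1 / of_nat j ^ 2) + of_nat p ^ 2 * (1 / of_nat j ^ 3)
    + of_nat p ^ 3 * (1 / of_nat j ^ 4) + of_nat p ^ 4 * (1 / of_nat j ^ 5))) \<in> I 5"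
    by (intro I_sum expand1 unit_index)
  moreover have "gharm 1 (p - 1) = (\<Sum>j=1..n. 1 / of_nat j + 1 / (of_nat p - of_nat j))"
    unfolding gharm_def sum_reflect using p_eq by (intro sum.cong) (auto simp: of_nat_diff)
  ultimately show ?thesis
    unfolding gharm_def by (simp add: sum.distrib sum_distrib_left)
qed

text \<open>The number expanded in \<open>gharm1_full1\<close>, now along
  \<open>{2j, p - 2j}\<close>: order \<open>r\<close> picks up the factor
  \<open>2^(-r)\<close>.\<close>

lemma gharm1_full2: "gharm 1 (p - 1) + (of_nat p * (gharm 2 n / 4) + of_nat p ^ 2 * (gharm 3 n / 8)
    + of_nat p ^ 3 * (gharm 4 n / 16) + of_nat p ^ 4 * (gharm 5 n / 32)) \<in> I 5"
proof -
  have "(\<Sum>j=1..n. 1 / of_nat (2*j) + 1 / (of_nat p - of_nat (2*j)) + (of_nat p * (1 / of_nat (2*j) ^ 2) + of_nat p ^ 2 * (1 / of_nat (2*j) ^ 3)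
    + of_nat p ^ 3 * (1 / of_nat (2*j) ^ 4) + of_nat p ^ 4 * (1 / of_nat (2*j) ^ 5))) \<in> I 5"
    by (intro I_sum expand1 unit_index)
  moreover have "gharm 1 (p - 1) = (\<Sum>j=1..n. 1 / of_nat (2*j) + 1 / (of_nat p - of_nat (2*j)))"
    unfolding gharm_def sum_parity using p_eq by (intro sum.cong) (auto simp: of_nat_diff)
  moreover note sum_even_powers[of _ n]
  ultimately show ?thesis
    unfolding sum.distrib by (simp only: sum_distrib_left[symmetric]) (simp add: algebra_simps)
qed

lemma gharm3_full1: "gharm 3 (p - 1) + (3 * of_nat p * gharm 4 n + 6 * of_nat p ^ 2 * gharm 5 n) \<in> I 3"
proof -
  have "(\<Sum>j=1..n. 1 / of_nat j ^ 3 + 1 / (of_nat p - of_nat j) ^ 3 + (3 * of_nat p * (1 / of_nat j ^ 4) + 6 * of_nat p ^ 2 * (1 / of_nat j ^ 5))) \<in> I 3"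
    by (intro I_sum expand3 unit_index)
  moreover have "gharm 3 (p - 1) = (\<Sum>j=1..n. 1 / of_nat j ^ 3 + 1 / (of_nat p - of_nat j) ^ 3)"
    unfolding gharm_def sum_reflect using p_eq by (intro sum.cong) (auto simp: of_nat_diff)
  ultimately show ?thesis
    unfolding gharm_def by (simp add: sum.distrib sum_distrib_left)
qed

lemma gharm3_full2: "gharm 3 (p - 1) + (3 * of_nat p * (gharm 4 n / 16) + 6 * of_nat p ^ 2 * (gharm 5 n / 32)) \<in> I 3"
proof -
  have "(\<Sum>j=1..n. 1 / of_nat (2*j) ^ 3 + 1 / (of_nat p - of_nat (2*j)) ^ 3 + (3 * of_nat p * (1 / of_nat (2*j) ^ 4) + 6 * of_nat p ^ 2 * (1 / of_nat (2*j) ^ 5))) \<in> I 3"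
    by (intro I_sum expand3 unit_index)
  moreover have "gharm 3 (p - 1) = (\<Sum>j=1..n. 1 / of_nat (2*j) ^ 3 + 1 / (of_nat p - of_nat (2*j)) ^ 3)"
    unfolding gharm_def sum_parity using p_eq by (intro sum.cong) (auto simp: of_nat_diff)
  moreover note sum_even_powers[of _ n]
  ultimately show ?thesis
    unfolding sum.distrib by (simp only: sum_distrib_left[symmetric]) (simp add: algebra_simps)
qed

lemma gharm_I: "k < p \<Longrightarrow> gharm r k \<in> I 0"
  unfolding gharm_def by (intro I_sum I_divide unit_power unit_small) auto

text \<open>Subtracting the two expansions eliminates \<open>H_(p-1)\<close>; the difference is then
  divided by \<open>p\<close>.\<close>

lemma gharm2_relation:
  "3/4 * gharm 2 n + 7/8 * of_nat p * gharm 3 n + 15/16 * of_nat p ^ 2 * gharm 4 n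
     + 31/32 * of_nat p ^ 3 * gharm 5 n \<in> I 4" (is "?x \<in> _")
proof (rule I_p_div[of 1])
  have "of_nat p ^ 1 * ?x =
    (gharm 1 (p - 1) + (of_nat p * gharm 2 n + of_nat p ^ 2 * gharm 3 n
    + of_nat p ^ 3 * gharm 4 n + of_nat p ^ 4 * gharm 5 n)) -
    (gharm 1 (p - 1) + (of_nat p * (gharm 2 n / 4) + of_nat p ^ 2 * (gharm 3 n / 8)
    + of_nat p ^ 3 * (gharm 4 n / 16) + of_nat p ^ 4 * (gharm 5 n / 32)))"
    by (simp add: algebra_simps power2_eq_square power3_eq_cube power4_eq_xxxx)
  then show "of_nat p ^ 1 * ?x \<in> I (1 + 4)"
    using I_diff[OF gharm1_full1 gharm1_full2] by simp
qed

text \<open>The same elimination for \<open>gharm 3 (p - 1)\<close>, with division by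
  \<open>3p\<close>.\<close>

lemma gharm4_relation: "15/16 * gharm 4 n + 31/16 * of_nat p * gharm 5 n \<in> I 2" (is "?x \<in> _")
proof (rule I_p_div[of 1], rule unit_cancel[OF unit_3])
  have "3 * (of_nat p ^ 1 * ?x) =
    gharm 3 (p - 1) + (3 * of_nat p * gharm 4 n + 6 * of_nat p ^ 2 * gharm 5 n) -
    (gharm 3 (p - 1) + (3 * of_nat p * (gharm 4 n / 16) + 6 * of_nat p ^ 2 * (gharm 5 n / 32)))"
    by (simp add: algebra_simps power2_eq_square)
  then show "3 * (of_nat p ^ 1 * ?x) \<in> I (1 + 2)"
    using I_diff[OF gharm3_full1 gharm3_full2] by (simp add: numeral_3_eq_3)
qed

lemma unit_16: "unit 16" "unit 8" "unit 32"
  using unit_power[OF unit_2, of 4] unit_power[OF unit_2, of 3] unit_power[OF unit_2, of 5] by simp_all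

text \<open>Modulo \<open>p\<close> only the first term of \<open>gharm2_relation\<close> survives.
  With \<open>gharm2_full\<close> this removes the \<open>gharm 2\<close> terms from central
  differences modulo \<open>p\<close>.\<close>

lemma gharm2_half: "gharm 2 n \<in> I 1"
proof -
  have n: "n < p" using p_eq by simp
  have "3/4 * gharm 2 n + of_nat p * (7/8 * gharm 3 n + 15/16 * of_nat p * gharm 4 n
     + 31/32 * of_nat p ^ 2 * gharm 5 n) \<in> I 1"
    using I_mono[OF _ gharm2_relation, of 1]
    by (simp add: algebra_simps power2_eq_square power3_eq_cube)
  moreover have "of_nat p * (7/8 * gharm 3 n + 15/16 * of_nat p * gharm 4 n
     + 31/32 * of_nat p ^ 2 * gharm 5 n) \<in> I 1"
    by (intro I_mult0'[OF I_p(1)] I_add I_mult0[of _ _ 0] I_divide[of _ 0] unit_16 I_power gharm_I n) auto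
  ultimately have "3/4 * gharm 2 n \<in> I 1" using I_diff by fastforce
  then show ?thesis by (rule unit_cancel[OF unit_div[OF unit_3 unit_4]])
qed

text \<open>Since \<open>1/(p - j)^2\<close> is congruent to \<open>1/j^2\<close>, the full sum is
  twice the half sum modulo \<open>p\<close>.\<close>

lemma gharm2_full: "gharm 2 (p - 1) \<in> I 1"
proof -
  have "gharm 2 (p - 1) - 2 * gharm 2 n = (\<Sum>j=1..n. 1 / (of_nat p - of_nat j) ^ 2 - 1 / of_nat j ^ 2)"
    unfolding gharm_def sum_reflect sum_distrib_left sum_subtractf[symmetric]
    using p_eq by (intro sum.cong) (auto simp: of_nat_diff)
  also have "\<dots> \<in> I 1"
  proof (rule I_sum)
    fix j assume j: "j \<in> {1..n}"
    define q where "q = (of_nat p :: rat)"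
    define a where "a = (of_nat j :: rat)"
    have u: "unit a" "unit (q - a)" using unit_index j by (auto simp: a_def q_def)
    then have nz: "a \<noteq> 0" "q - a \<noteq> 0" by (auto simp: unit_def)
    have "1 / (q - a) ^ 2 - 1 / a ^ 2 = q * (2 * a - q) / ((q - a) ^ 2 * a ^ 2)"
      using nz by (simp add: divide_simps) Groebner_Basis.algebra
    also have "\<dots> \<in> I 1" using u unfolding q_def
      by (intro I_divide unit_mult unit_power I_mult0'[OF I_p(1)] I_diff I_mult0[of _ _ 0]) (auto intro: unit_I)
    finally show "1 / (of_nat p - of_nat j :: rat) ^ 2 - 1 / of_nat j ^ 2 \<in> I 1"
      by (simp add: q_def a_def)
  qed
  finally have "gharm 2 (p - 1) - 2 * gharm 2 n \<in> I 1" .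
  moreover have "2 * gharm 2 n \<in> I 1" using gharm2_half by (intro I_mult0) auto
  ultimately show ?thesis using I_add by fastforce
qed

section \<open>Power sums and the half sums of orders 5 and 3\<close>

lemma IP_poly_cong:
  assumes "f \<in> IP 0" "x \<in> I 0" "y \<in> I 0" "x - y \<in> I m"
  shows "poly f x - poly f y \<in> I m"
  using assms(1)
proof (induction f)
  case (pCons a f)
  have "poly (pCons a f) x - poly (pCons a f) y = x * (poly f x - poly f y) + (x - y) * poly f y"
    by (simp add: algebra_simps)
  also have "\<dots> \<in> I m"
    using pCons assms by (intro I_add I_mult0 I_mult0' IP_poly) (auto simp: IP_pCons)
  finally show ?case .
qed simp

lemma central_bernpoly_telescope:
  "(\<Sum>j=1..k. of_nat (Suc m) * of_nat j ^ m) =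
     poly (central_bernpoly (Suc m)) (of_nat k + 1/2) - poly (central_bernpoly (Suc m)) (1/2)"
proof (induction k)
  case (Suc k)
  then show ?case using central_bernpoly_diff[of m "of_nat (Suc k)"]
    by (simp add: algebra_simps)
qed simp

lemma half_index: "of_nat n + 1/2 = (of_nat p / 2 :: rat)"
  by (simp add: p_eq field_simps)

lemma half_p_I: "of_nat p / 2 \<in> I 1" "of_nat p / 2 \<in> I 0"
  using I_half[OF I_p(1)] I_half[of "of_nat p" 0] by auto

lemma fermat_div: assumes "0 < j" "j < p" "k \<le> p - 1"
  shows "1 / of_nat j ^ k - of_nat j ^ (p - 1 - k) \<in> I 1"
proof -
  have u: "unit (of_nat j)" using assms by (intro unit_small) auto
  have "of_nat j ^ (p - 1) = (of_nat j ^ (p - 1 - k) * of_nat j ^ k :: rat)"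
    using assms by (simp flip: power_add)
  then have "1 / of_nat j ^ k - of_nat j ^ (p - 1 - k) = - ((of_nat j ^ (p - 1) - 1) / of_nat j ^ k :: rat)"
    using u by (simp add: field_simps unit_def)
  also have "\<dots> \<in> I 1" using assms u by (intro I_minus I_divide fermat unit_power) (auto dest: dvd_imp_le)
  finally show ?thesis .
qed

lemma bernoulli_I: "bernoulli (p - 5) \<in> I 0"
  unfolding bernoulli_def by (intro I_mult0 bernoulli_gf_I) auto

text \<open>By Fermat \<open>1/j^5\<close> becomes \<open>j^(p-6)\<close>, whose sum times
  \<open>p - 5\<close> is a difference of Bernoulli polynomial values, congruent to
  \<open>31 B - B\<close> for \<open>B = bernoulli (p - 5)\<close>. As \<open>p - 5\<close> is
  \<open>-5\<close> modulo \<open>p\<close>, the quotient is \<open>-6 B\<close>.\<close>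

lemma gharm5_half:
  assumes "p > 5"
  shows "gharm 5 n + 6 * bernoulli (p - 5) \<in> I 1"
proof -
  define m where "m = p - 6"
  have m: "p - 5 = Suc m" "m \<noteq> 0" using p_ge_5 assms p_eq by (auto simp: m_def)
  let ?b = "central_bernpoly (Suc m)"
  have b0: "?b \<in> IP 0" using m by (intro central_bernpoly_IP) simp
  have "(\<Sum>j=1..n. 1 / of_nat j ^ 5 - of_nat j ^ m) \<in> I 1"
  proof (rule I_sum)
    fix j assume "j \<in> {1..n}"
    moreover have "m = p - 1 - 5" using m by simp
    ultimately show "1 / of_nat j ^ 5 - of_nat j ^ m \<in> I 1"
      using fermat_div[of j 5] p_eq assms by simp
  qed
  then have 1: "of_nat (Suc m) * (gharm 5 n - (\<Sum>j=1..n. of_nat j ^ m)) \<in> I 1"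
    unfolding gharm_def sum_subtractf by (intro I_mult0 I_of_nat)
  have "of_nat (Suc m) * (\<Sum>j=1..n. of_nat j ^ m) = poly ?b (of_nat p / 2) - poly ?b (1/2)"
    unfolding sum_distrib_left central_bernpoly_telescope half_index ..
  \<comment> \<open>The term \<open>fps_X\<close> in \<open>central_gf_exp\<close> contributes at
    index 1 only, which \<open>m \<noteq> 0\<close> excludes.\<close>
  moreover have "poly ?b (1/2) = bernoulli (p - 5)"
    unfolding poly_central_bernpoly central_gf_exp m(1) bernoulli_def using m(2) by simp
  moreover have "poly ?b 0 = fact (p - 5) * fps_nth central_gf (p - 5)"
    unfolding poly_central_bernpoly m(1) by simp
  moreover have "poly ?b (of_nat p / 2) - poly ?b 0 \<in> I 1"
    using half_p_I by (intro IP_poly_cong b0) auto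
  ultimately have 2: "of_nat (Suc m) * (\<Sum>j=1..n. of_nat j ^ m) + bernoulli (p - 5) - 31 * bernoulli (p - 5) \<in> I 1"
    using I_add[OF _ central_gf_cong, of "poly ?b (of_nat p / 2) - poly ?b 0"] by simp
  have 3: "of_nat (Suc m) = (of_nat p - 5 :: rat)" using m assms by (simp flip: m(1) add: of_nat_diff)
  have 4: "of_nat p * gharm 5 n \<in> I 1" using p_eq by (intro I_mult0'[OF I_p(1)] gharm_I) simp
  have "5 * (gharm 5 n + 6 * bernoulli (p - 5)) = of_nat p * gharm 5 n
     - (of_nat (Suc m) * (gharm 5 n - (\<Sum>j=1..n. of_nat j ^ m)) + (of_nat (Suc m) * (\<Sum>j=1..n. of_nat j ^ m) + bernoulli (p - 5) - 31 * bernoulli (p - 5)))"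
    unfolding 3 by (simp add: algebra_simps)
  also have "\<dots> \<in> I 1" using 1 2 4 by blast
  finally show ?thesis by (rule unit_cancel[rotated]) (use unit_small[of 5] assms in simp)
qed

lemma gharm3_half:
  assumes "p > 5"
  shows "gharm 3 n - 6 * gharm 1 (p - 1) / of_nat p ^ 2 + 81/10 * of_nat p ^ 2 * bernoulli (p - 5) \<in> I 3"
    (is "?l \<in> _")
proof (rule I_p_div[of 2])
  define q where "q = (of_nat p :: rat)"
  define X where "X = gharm 1 (p - 1) + (q * gharm 2 n + q ^ 2 * gharm 3 n + q ^ 3 * gharm 4 n + q ^ 4 * gharm 5 n)"
  define Y where "Y = 3/4 * gharm 2 n + 7/8 * q * gharm 3 n + 15/16 * q ^ 2 * gharm 4 n + 31/32 * q ^ 3 * gharm 5 n"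
  define Z where "Z = 15/16 * gharm 4 n + 31/16 * q * gharm 5 n"
  define V where "V = gharm 5 n + 6 * bernoulli (p - 5)"
  have mem: "X \<in> I 5" "Y \<in> I 4" "Z \<in> I 2" "V \<in> I 1"
    unfolding X_def Y_def Z_def V_def q_def
    by (rule gharm1_full1 gharm2_relation gharm4_relation gharm5_half[OF assms])+
  have q: "q \<noteq> 0" using gt3 by (simp add: q_def)
  have u5: "unit 5" using unit_small[of 5] assms by simp
  then have u20: "unit 20" using unit_mult[OF unit_4 u5] by simp
  \<comment> \<open>The coefficients solve a triangular system: \<open>Y\<close> removes
    \<open>gharm 2 n\<close>, \<open>Z\<close> removes \<open>gharm 4 n\<close>, and
    \<open>V\<close> trades \<open>gharm 5 n\<close> for the Bernoulli number. The denominators 5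
    and 20 are units because \<open>p > 5\<close>.\<close>
  have "q ^ 2 * ?l = - 6 * X + 8 * (q ^ 1 * Y) - 8 / 5 * (q ^ 3 * Z) + 27 / 20 * (q ^ 4 * V)"
    using q unfolding X_def Y_def Z_def V_def q_def[symmetric] by (simp add: field_simps) Groebner_Basis.algebra
  also have "\<dots> \<in> I 5"
  proof -
    have q: "q ^ k \<in> I k" for k by (simp add: q_def)
    have YZV: "q ^ 1 * Y \<in> I 5" "q ^ 3 * Z \<in> I 5" "q ^ 4 * V \<in> I 5"
      using I_mult[OF q[of 1] mem(2)] I_mult[OF q[of 3] mem(3)] I_mult[OF q[of 4] mem(4)] by simp_all
    have "- 6 \<in> I 0" "8 / 5 \<in> I 0" "27 / 20 \<in> I 0"
      using I_of_int[of "- 6"] u5 u20 by (auto intro: I_divide)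
    then show ?thesis
      by (intro I_add[OF I_diff[OF I_add]] I_mult0[OF _ mem(1)] I_mult0[OF _ YZV(1)]
          I_mult0[OF _ YZV(2)] I_mult0[OF _ YZV(3)]) auto
  qed
  finally show "of_nat p ^ 2 * ?l \<in> I (2 + 3)" by (simp add: q_def)
qed

end

section \<open>The deformed sum\<close>

text \<open>At 0 this is the squared rising factorial \<open>(1/2)_k^2\<close>, the source of
  \<open>binomial(2k, k)^2 / 16^k\<close>.\<close>

definition half_prod :: "nat \<Rightarrow> rat poly" where
  "half_prod k = (\<Prod>j=1..k. [:(of_nat j - 1/2) ^ 2, 0, -1:])"

definition int_prod :: "nat \<Rightarrow> rat poly" where
  "int_prod k = (\<Prod>j=1..k. [:1, 0, - 1 / of_nat j ^ 2:])"

definition weight :: "nat \<Rightarrow> rat" where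
  "weight k = gharm 2 k / (of_nat k * fact k ^ 2)"

text \<open>The polynomial \<open>F_K\<close> of the overview; \<open>int_prod K\<close> is its
  \<open>P_K\<close>.\<close>

definition harm_poly :: "nat \<Rightarrow> rat poly" where
  "harm_poly K = (\<Sum>k=1..K. smult (weight k) (half_prod k))"

lemma prod_half: "(\<Prod>j=1..k. of_nat j - 1/2 :: rat) = fact (2 * k) / (4 ^ k * fact k)"
proof (induction k)
  case (Suc k)
  have "fact (2 * Suc k) = (fact (2 * k) * (2 * of_nat k + 1) * (2 * of_nat k + 2) :: rat)"
    by (simp add: algebra_simps)
  moreover have "(\<Prod>j=1..Suc k. of_nat j - 1/2 :: rat) = fact (2 * k) / (4 ^ k * fact k) * (of_nat k + 1/2)"
    using Suc by (simp add: algebra_simps)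
  moreover have "a / (b * d) * (c + 1/2) = a * (2 * c + 1) * (2 * c + 2) / (4 * b * ((c + 1) * d))"
    if "c + 1 \<noteq> 0" "b \<noteq> 0" "d \<noteq> 0" for a b c d :: rat
    using that by (simp add: divide_simps)
  ultimately show ?case by (simp add: add.commute)
qed simp

lemma weight_half_prod: "weight k * poly (half_prod k) 0 =
  gharm 2 k / (of_nat k * 16 ^ k) * of_nat ((2 * k) choose k) ^ 2"
proof -
  have "poly (half_prod k) 0 = (\<Prod>j=1..k. of_nat j - 1/2) ^ 2"
    by (simp add: half_prod_def poly_prod prod_power_distrib)
  also have "\<dots> = (fact (2 * k) / (4 ^ k * fact k)) ^ 2" unfolding prod_half ..
  also have "\<dots> = (fact k * of_nat ((2 * k) choose k) / 4 ^ k) ^ 2"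
    by (subst binomial_fact) (auto simp: field_simps)
  also have "\<dots> = fact k ^ 2 * of_nat ((2 * k) choose k) ^ 2 / (4 ^ k) ^ 2"
    by (simp add: power_divide power_mult_distrib)
  also have "(4 ^ k) ^ 2 = (16 ^ k :: rat)" by (simp add: power2_eq_square flip: power_mult_distrib)
  finally show ?thesis by (simp add: weight_def)
qed

lemma half_prod_even: "poly (half_prod k) (- x) = poly (half_prod k) x"
  by (simp add: half_prod_def poly_prod)

lemma poly_half_prod_Suc: "poly (half_prod (Suc k)) x
    = poly (half_prod k) x * ((of_nat (Suc k) - 1/2) ^ 2 - x ^ 2)"
  by (simp add: half_prod_def power2_eq_square[of x] left_diff_distrib mult_ac)

text \<open>The factors split as \<open>(j - 1 - x)(j + x)\<close>; regrouping them leaves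
  \<open>j^2 - x^2\<close> and two end factors.\<close>

lemma half_prod_shift_up: "poly (half_prod (Suc k)) (x + 1/2)
    = - x * (of_nat (Suc k) + x) * (\<Prod>j=1..k. of_nat j ^ 2 - x ^ 2)"
proof (induction k)
  case 0
  show ?case by (simp add: half_prod_def power2_eq_square algebra_simps)
next
  case (Suc k)
  define P where "P = (\<Prod>j=1..k. of_nat j ^ 2 - x ^ 2)"
  have "poly (half_prod (Suc (Suc k))) (x + 1/2) =
     poly (half_prod (Suc k)) (x + 1/2) * ((of_nat (Suc (Suc k)) - 1/2) ^ 2 - (x + 1/2) ^ 2)"
    by (rule poly_half_prod_Suc)
  also have "\<dots> = (- x * (of_nat (Suc k) + x) * P) * ((of_nat (Suc k) - x) * (of_nat (Suc (Suc k)) + x))"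
    unfolding Suc.IH P_def[symmetric] by (simp add: power2_eq_square field_simps)
  also have "\<dots> = - x * (of_nat (Suc (Suc k)) + x) * (P * (of_nat (Suc k) ^ 2 - x ^ 2))"
    by (simp add: power2_eq_square algebra_simps)
  finally show ?case by (simp add: P_def)
qed

lemma half_prod_shift_down: "poly (half_prod (Suc k)) (x - 1/2)
    = x * (of_nat (Suc k) - x) * (\<Prod>j=1..k. of_nat j ^ 2 - x ^ 2)"
  using half_prod_shift_up[of k "- x"] half_prod_even[of "Suc k" "x - 1/2"] by simp

lemma poly_int_prod: "poly (int_prod k) x = (\<Prod>j=1..k. of_nat j ^ 2 - x ^ 2) / fact k ^ 2"
proof (induction k)
  case (Suc k)
  have "poly (int_prod (Suc k)) x = poly (int_prod k) x * (1 - x ^ 2 / of_nat (Suc k) ^ 2)"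
    unfolding int_prod_def by (simp add: power2_eq_square algebra_simps)
  then show ?case unfolding Suc.IH
    by (simp add: field_simps power2_eq_square del: of_nat_Suc)
qed (simp add: int_prod_def)

text \<open>In the induction step the two shifted products share a factor \<open>M\<close> and
  differ by \<open>-2 x (k + 1) M\<close>. Multiplying by \<open>x^3\<close> keeps the identity
  valid at 0.\<close>

lemma harm_poly_diff:
  "x ^ 3 * (poly (harm_poly K) (x + 1/2) - poly (harm_poly K) (x - 1/2))
    = 2 * (x ^ 2 * gharm 2 K * poly (int_prod K) x + poly (int_prod K) x - 1)"
proof (induction K)
  case 0
  show ?case by (simp add: harm_poly_def gharm_def int_prod_def)
next
  case (Suc k)
  define c where "c = (of_nat (Suc k) :: rat)"
  define F where "F = (fact k ^ 2 :: rat)"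
  define M where "M = (\<Prod>j=1..k. of_nat j ^ 2 - x ^ 2)"
  define H where "H = gharm 2 k"
  have nz: "c \<noteq> 0" "F \<noteq> 0" by (simp_all add: c_def F_def)
  have w: "weight (Suc k) = (H + 1 / c ^ 2) / (c * (c ^ 2 * F))"
    by (simp add: weight_def gharm_def H_def c_def F_def power_mult_distrib)
  have "poly (harm_poly (Suc k)) y = poly (harm_poly k) y + weight (Suc k) * poly (half_prod (Suc k)) y" for y
    by (simp add: harm_poly_def)
  then have "x ^ 3 * (poly (harm_poly (Suc k)) (x + 1/2) - poly (harm_poly (Suc k)) (x - 1/2)) =
     x ^ 3 * (poly (harm_poly k) (x + 1/2) - poly (harm_poly k) (x - 1/2))
     + x ^ 3 * weight (Suc k) * (poly (half_prod (Suc k)) (x + 1/2) - poly (half_prod (Suc k)) (x - 1/2))"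
    by (simp add: algebra_simps)
  also have "\<dots> = 2 * (x ^ 2 * H * (M / F) + M / F - 1)
     + x ^ 3 * ((H + 1 / c ^ 2) / (c * (c ^ 2 * F))) * (- x * (c + x) * M - x * (c - x) * M)"
    unfolding Suc.IH w half_prod_shift_up half_prod_shift_down poly_int_prod M_def c_def F_def H_def by simp
  also have "\<dots> = 2 * (x ^ 2 * (H + 1 / c ^ 2) * (M * (c ^ 2 - x ^ 2) / (c ^ 2 * F)) + M * (c ^ 2 - x ^ 2) / (c ^ 2 * F) - 1)"
    using nz by (simp add: divide_simps) Groebner_Basis.algebra
  also have "M * (c ^ 2 - x ^ 2) / (c ^ 2 * F) = poly (int_prod (Suc k)) x"
    unfolding poly_int_prod by (simp add: M_def c_def F_def power_mult_distrib)
  also have "H + 1 / c ^ 2 = gharm 2 (Suc k)" by (simp add: H_def gharm_def c_def)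
  finally show ?case .
qed

lemma poly_int_prod_root: "1 \<le> m \<Longrightarrow> m \<le> k \<Longrightarrow> poly (int_prod k) (of_nat m) = 0"
  by (auto simp: poly_int_prod intro!: prod_zero bexI[of _ m])

text \<open>\<open>int_prod K\<close> vanishes at \<open>1, ..., K\<close>, so the difference there
  is \<open>-2/x^3\<close> and telescopes. The value at \<open>1/2\<close> is 0 because the factor
  \<open>j = 1\<close> vanishes.\<close>

lemma harm_poly_half: "k \<le> K \<Longrightarrow> poly (harm_poly K) (of_nat k + 1/2) = - 2 * gharm 3 k"
proof (induction k)
  case 0
  have "poly (half_prod j) (1/2) = 0" if "1 \<le> j" for j
    using that unfolding half_prod_def poly_prod by (intro prod_zero) (auto intro!: bexI[of _ 1] simp: power2_eq_square)
  then show ?case by (simp add: harm_poly_def poly_sum gharm_def)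
next
  case (Suc k)
  define x where "x = (of_nat (Suc k) :: rat)"
  have "x \<noteq> 0" by (simp add: x_def)
  have r: "poly (int_prod K) x = 0" unfolding x_def using Suc.prems by (intro poly_int_prod_root) auto
  have "x ^ 3 * (poly (harm_poly K) (x + 1/2) - poly (harm_poly K) (x - 1/2)) = - 2"
    unfolding harm_poly_diff r by simp
  then have "poly (harm_poly K) (x + 1/2) = poly (harm_poly K) (x - 1/2) - 2 / x ^ 3"
    using \<open>x \<noteq> 0\<close> by (simp add: field_simps)
  moreover have "x - 1/2 = of_nat k + 1/2" by (simp add: x_def)
  ultimately show ?case using Suc by (simp add: gharm_def x_def add.commute)
qed

lemma degree_half_prod: "degree (half_prod k) \<le> 2 * k"
proof -
  have "degree (half_prod k) \<le> (\<Sum>j=1..k. degree [:(of_nat j - 1/2) ^ 2 :: rat, 0, -1:])"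
    unfolding half_prod_def using degree_prod_sum_le[of "{1..k}" "\<lambda>j. [:(of_nat j - 1/2) ^ 2 :: rat, 0, -1:]"]
    by (simp only: o_def finite_atLeastAtMost)
  then show ?thesis by simp
qed

lemma degree_harm_poly: "degree (harm_poly K) \<le> 2 * K"
  unfolding harm_poly_def
  by (intro degree_sum_le) (auto intro!: order_trans[OF degree_smult_le] order_trans[OF degree_half_prod])

section \<open>The lower half of the sum modulo \<open>p^3\<close>\<close>

context prime_gt3 begin

lemma half_prod_IP: "half_prod k \<in> IP 0"
  unfolding half_prod_def by (intro IP_prod) (auto simp: IP_pCons intro!: I_power I_minus)

lemma weight_I: "1 \<le> k \<Longrightarrow> k < p \<Longrightarrow> weight k \<in> I 0"
  unfolding weight_def by (intro I_divide gharm_I unit_mult unit_power unit_fact unit_small) auto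

lemma harm_poly_IP: "K < p \<Longrightarrow> harm_poly K \<in> IP 0"
  unfolding harm_poly_def by (intro IP_sum IP_smult half_prod_IP weight_I) auto

lemma int_prod_IP: "K < p \<Longrightarrow> int_prod K \<in> IP 0"
  unfolding int_prod_def
  by (intro IP_prod) (auto simp: IP_pCons intro!: I_minus I_divide unit_power unit_small)

lemma poly_second_order: assumes "f \<in> IP 0" "x \<in> I 1"
  shows "poly f x - (coeff f 0 + coeff f 1 * x + coeff f 2 * x ^ 2) \<in> I 3"
proof -
  obtain a b c g where f: "f = pCons a (pCons b (pCons c g))" by (metis pCons_cases)
  have "poly f x - (coeff f 0 + coeff f 1 * x + coeff f 2 * x ^ 2) = x ^ 3 * poly g x"
    by (simp add: f numeral_2_eq_2 power3_eq_cube algebra_simps)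
  also have "\<dots> \<in> I 3"
    using assms I_mono[of 0 1 x] by (intro I_mult0'[OF I_power1] IP_poly) (auto simp: f IP_pCons)
  finally show ?thesis .
qed

text \<open>Evenness at the single point \<open>x\<close> puts the linear coefficient in \<open>p\<^sup>2 \<int>\<^sub>p\<close>, which suffices.\<close>
lemma even_poly_zero:
  assumes "f \<in> IP 0" "x \<in> I 1" "poly f (- x) = poly f x"
  shows "poly f 0 - (poly f x - coeff f 2 * x ^ 2) \<in> I 3"
proof (rule unit_cancel[OF unit_2])
  have "- (poly f x - (coeff f 0 + coeff f 1 * x + coeff f 2 * x ^ 2))
     - (poly f (- x) - (coeff f 0 + coeff f 1 * (- x) + coeff f 2 * (- x) ^ 2)) \<in> I 3"
    using assms by (intro I_diff I_minus poly_second_order) auto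
  then show "2 * (poly f 0 - (poly f x - coeff f 2 * x ^ 2)) \<in> I 3"
    unfolding assms(3) poly_0_coeff_0 by (simp add: algebra_simps)
qed

text \<open>For \<open>m > n\<close> the numerator has the factor
  \<open>(p - m)^2 - m^2 = p (p - 2m)\<close>.\<close>

lemma int_prod_half_cong: assumes "m \<in> {1..p-1}" shows "poly (int_prod n) (of_nat m) \<in> I 1"
proof (cases "m \<le> n")
  case True
  then show ?thesis using assms by (simp add: poly_int_prod_root)
next
  case False
  have "(\<Prod>j=1..n. of_nat j ^ 2 - of_nat m ^ 2) =
     (of_nat (p - m) ^ 2 - of_nat m ^ 2) * (\<Prod>j\<in>{1..n}-{p - m}. of_nat j ^ 2 - of_nat m ^ 2 :: rat)"
    using assms False p_eq by (intro prod.remove) auto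
  also have "of_nat (p - m) ^ 2 - of_nat m ^ 2 = (of_nat p * (of_nat p - 2 * of_nat m) :: rat)"
  proof -
    have "m \<le> p" using assms by auto
    then show ?thesis by (simp add: of_nat_diff power2_eq_square algebra_simps)
  qed
  also have "of_nat p * (of_nat p - 2 * of_nat m) * (\<Prod>j\<in>{1..n}-{p - m}. of_nat j ^ 2 - of_nat m ^ 2 :: rat) \<in> I 1"
    by (intro I_mult0' I_p I_prod I_diff I_power I_mult0[of _ _ 0]) auto
  finally show ?thesis unfolding poly_int_prod
    using p_eq by (intro I_divide unit_power unit_fact) auto
qed

text \<open>A complete residue system modulo \<open>p\<close>, used at integers and at
  half-integers.\<close>

definition residue_points :: "rat \<Rightarrow> rat set" where
  "residue_points c = (\<lambda>m. of_nat m + c) ` {0..<p}"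

lemma residue_points: "finite (residue_points c)" "card (residue_points c) = p"
    "c \<in> I 0 \<Longrightarrow> residue_points c \<subseteq> I 0"
    "\<And>x y. x \<in> residue_points c \<Longrightarrow> y \<in> residue_points c \<Longrightarrow> x \<noteq> y \<Longrightarrow> unit (x - y)"
proof -
  show "finite (residue_points c)" by (simp add: residue_points_def)
  show "residue_points c \<subseteq> I 0" if "c \<in> I 0" using that by (auto simp: residue_points_def)
  show "card (residue_points c) = p"
    unfolding residue_points_def by (subst card_image) (auto simp: inj_on_def)
  fix x y assume "x \<in> residue_points c" "y \<in> residue_points c" "x \<noteq> y"
  then obtain i j where ij: "x = of_nat i + c" "y = of_nat j + c" "i < p" "j < p" "i \<noteq> j"
    by (auto simp: residue_points_def)
  have "\<not> int p dvd int i - int j"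
    using ij dvd_imp_le_int[of "int i - int j" "int p"] by auto
  then show "unit (x - y)" using unit_of_int[of "int i - int j"] ij by simp
qed

lemma residue_lagrange:
  assumes "c \<in> I 0" "f \<in> IP 0" "degree f < p" "\<And>m. m < p \<Longrightarrow> poly f (of_nat m + c) \<in> I 1"
  shows "f \<in> IP 1"
proof (rule lagrange[OF residue_points(1) assms(2) _ residue_points(3)[OF assms(1)] residue_points(4)])
  show "degree f < card (residue_points c)" using assms(3) by (simp add: residue_points(2))
qed (use assms(4) in \<open>auto simp: residue_points_def\<close>)

text \<open>The hypothesis makes \<open>u\<close> constant modulo \<open>p\<close> on
  \<open>p\<close> half-integers, hence constant as a polynomial by the degree bound. The point
  \<open>x = 0\<close> is left out, so differences known only after division by \<open>x^3\<close>
  are admissible.\<close>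

lemma periodic_coeff:
  assumes "u \<in> IP 0" "degree u < p"
    "\<And>m. m \<in> {1..p-1} \<Longrightarrow> poly u (of_nat m + 1/2) - poly u (of_nat m - 1/2) \<in> I 1"
    "i \<ge> 1"
  shows "coeff u i \<in> I 1"
proof -
  define c where "c = poly u (1/2)"
  have *: "poly u (of_nat m + 1/2) - c \<in> I 1" if "m < p" for m
    using that
  proof (induction m)
    case 0
    show ?case by (simp add: c_def)
  next
    case (Suc m)
    have "(of_nat (Suc m) - 1/2 :: rat) = of_nat m + 1/2" by simp
    then have "poly u (of_nat (Suc m) + 1/2) - poly u (of_nat m + 1/2) \<in> I 1"
      using assms(3)[of "Suc m"] Suc.prems by (simp only: atLeastAtMost_iff) simp
    from I_add[OF this Suc.IH] Suc.prems show ?case by simp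
  qed
  have "u - [:c:] \<in> IP 1"
  proof (rule residue_lagrange[of "1 / 2"])
    show "u - [:c:] \<in> IP 0" using assms(1) unfolding c_def
      by (intro IP_diff) (auto simp: IP_pCons intro: IP_poly)
    show "degree (u - [:c:]) < p"
      using assms(2) by (intro le_less_trans[OF degree_diff_le_max]) auto
    show "poly (u - [:c:]) (of_nat m + 1 / 2) \<in> I 1" if "m < p" for m
      using *[OF that] by simp
  qed simp
  from IP_coeff[OF this, of i] show ?thesis using assms(4) by (cases i) auto
qed

lemma harm_poly_coeff2: "coeff (harm_poly n) 2 - 124 * bernoulli (p - 5) \<in> I 1"
proof -
  define m where "m = p - 4"
  have m: "p - 3 = Suc m" "p - 4 = m" "of_nat m = (of_nat p - 4 :: rat)" "m = Suc (p - 5)" "m < p" "Suc m \<le> p - 2"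
    using p_ge_5 by (auto simp: m_def of_nat_diff)
  \<comment> \<open>\<open>G\<close> has central difference \<open>-2 x^(p-4)\<close>, which by
    Fermat matches the \<open>-2/x^3\<close> of \<open>harm_poly n\<close>.\<close>
  define G where "G = smult (- 2 / of_nat (Suc m)) (central_bernpoly (Suc m))"
  have um: "unit (of_nat (Suc m))" using m p_ge_5 by (intro unit_small) auto
  have G: "G \<in> IP 0" unfolding G_def using um m(6)
    by (intro IP_smult I_divide central_bernpoly_IP I_minus) auto
  define u where "u = harm_poly n - G"
  have np: "n < p" using p_eq by simp
  have "coeff u 2 \<in> I 1"
  proof (rule periodic_coeff)
    show "u \<in> IP 0" unfolding u_def using G np by (intro IP_diff harm_poly_IP)
    have "degree G < p" unfolding G_def using m p_ge_5
      by (intro le_less_trans[OF degree_smult_le] le_less_trans[OF degree_central_bernpoly]) auto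
    then show "degree u < p"
      unfolding u_def using degree_harm_poly[of n] p_eq by (intro le_less_trans[OF degree_diff_le_max]) auto
    fix k assume k: "k \<in> {1..p-1}"
    define x where "x = (of_nat k :: rat)"
    have ux: "unit x" unfolding x_def using k by (intro unit_small) auto
    then have x: "x \<noteq> 0" "x \<in> I 0" by (auto simp: unit_def)
    define Q where "Q = poly (int_prod n) x"
    have Q: "Q \<in> I 1" unfolding Q_def x_def using k by (rule int_prod_half_cong)
    have "poly G (x + 1/2) - poly G (x - 1/2) = - 2 / of_nat (Suc m) *
       (poly (central_bernpoly (Suc m)) (x + 1/2) - poly (central_bernpoly (Suc m)) (x - 1/2))"
      unfolding G_def by (simp add: algebra_simps)
    also have "\<dots> = - 2 * x ^ m" unfolding central_bernpoly_diff by simp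
    finally have dG: "poly G (x + 1/2) - poly G (x - 1/2) = - 2 * x ^ m" .
    have dF: "poly (harm_poly n) (x + 1/2) - poly (harm_poly n) (x - 1/2)
       = 2 * (x ^ 2 * gharm 2 n * Q + Q - 1) / x ^ 3"
      using harm_poly_diff[of x n] x by (simp add: Q_def field_simps)
    have "poly u (x + 1/2) - poly u (x - 1/2) = 2 * (x ^ 2 * gharm 2 n * Q + Q) / x ^ 3 - 2 * (1 / x ^ 3 - x ^ m)"
      using dG dF unfolding u_def by (simp add: diff_divide_distrib algebra_simps)
    also have "\<dots> \<in> I 1"
    proof -
      have "1 / x ^ 3 - x ^ m \<in> I 1"
      proof -
        have "0 < k" "k < p" "3 \<le> p - 1" "p - 1 - 3 = m" using k p_ge_5 by (auto simp: m_def)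
        then show ?thesis using fermat_div[of k 3] by (simp only: x_def)
      qed
      moreover have "2 * (x ^ 2 * gharm 2 n * Q + Q) / x ^ 3 \<in> I 1"
        by (intro I_divide unit_power ux I_mult0 I_add Q I_power x gharm_I np) auto
      ultimately show ?thesis using I_diff[OF _ I_mult0[OF I_numeral(1)]] by blast
    qed
    finally show "poly u (of_nat k + 1/2) - poly u (of_nat k - 1/2) \<in> I 1" by (simp add: x_def)
  qed simp
  \<comment> \<open>Here \<open>m = p - 4\<close> is \<open>-4\<close> modulo \<open>p\<close>; with
    the 31 of \<open>central_gf_cong\<close> this gives 124.\<close>
  moreover have "coeff G 2 = - of_nat m * (fact (p - 5) * fps_nth central_gf (p - 5))"
    using m p_ge_5 unfolding G_def by (simp add: coeff_central_bernpoly) (simp add: left_diff_distrib)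
  ultimately have 1: "coeff (harm_poly n) 2 + of_nat m * (fact (p - 5) * fps_nth central_gf (p - 5)) \<in> I 1"
    by (simp add: u_def)
  have "coeff (harm_poly n) 2 - 124 * bernoulli (p - 5) =
     (coeff (harm_poly n) 2 + of_nat m * (fact (p - 5) * fps_nth central_gf (p - 5)))
     - of_nat m * (fact (p - 5) * fps_nth central_gf (p - 5) - 31 * bernoulli (p - 5))
     - of_nat p * (31 * bernoulli (p - 5))"
    unfolding m(3) by (simp add: algebra_simps)
  also have "\<dots> \<in> I 1"
    by (intro I_diff 1 I_mult0[OF I_of_nat] central_gf_cong I_mult0'[OF I_p(1)] I_mult0[of _ _ 0] bernoulli_I) auto
  finally show ?thesis .
qed

text \<open>The value at \<open>p/2 = n + 1/2\<close> is known exactly, and the correction is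
  \<open>124 (p/2)^2 = 31 p^2\<close> times the Bernoulli number.\<close>

lemma harm_poly_half_zero:
  "poly (harm_poly n) 0 - (- 2 * gharm 3 n - 31 * of_nat p ^ 2 * bernoulli (p - 5)) \<in> I 3"
proof -
  let ?c = "coeff (harm_poly n) 2" and ?x = "of_nat p / 2 :: rat"
  have "poly (harm_poly n) 0 - (poly (harm_poly n) ?x - ?c * ?x ^ 2) \<in> I 3"
    using p_eq half_p_I by (intro even_poly_zero harm_poly_IP)
      (auto simp: harm_poly_def poly_sum half_prod_even)
  also have "poly (harm_poly n) ?x = - 2 * gharm 3 n"
    using harm_poly_half[of n n] by (simp add: half_index)
  finally have 1: "poly (harm_poly n) 0 - (- 2 * gharm 3 n - ?c * ?x ^ 2) \<in> I 3" .
  have 2: "?x ^ 2 * (?c - 124 * bernoulli (p - 5)) \<in> I 3"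
    using I_mult[OF I_power1[OF half_p_I(1), of 2] harm_poly_coeff2] by (simp add: numeral_3_eq_3)
  show ?thesis using I_diff[OF 1 2] by (simp add: power_divide algebra_simps)
qed

end

section \<open>The upper half of the sum\<close>

text \<open>An operator on polynomials: \<open>x^p - x\<close> vanishes modulo \<open>p\<close> at
  every integer, so it can be cancelled only at the level of coefficients.\<close>

definition central_diff :: "rat poly \<Rightarrow> rat poly" where
  "central_diff f = pcompose f [:1/2, 1:] - pcompose f [:- 1/2, 1:]"

lemma poly_central_diff: "poly (central_diff f) x = poly f (x + 1/2) - poly f (x - 1/2)"
  by (simp add: central_diff_def poly_pcompose add.commute)

lemma central_diff_diff: "central_diff (f - g) = central_diff f - central_diff g"
  by (simp add: central_diff_def pcompose_diff)

lemma central_diff_harm_poly: "monom 1 3 * central_diff (harm_poly K)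
    = smult 2 (smult (gharm 2 K) (monom 1 2 * int_prod K) + int_prod K - 1)"
  unfolding poly_eq_poly_eq_iff[symmetric]
  by (rule ext) (use harm_poly_diff[of _ K] in \<open>simp add: poly_central_diff poly_monom algebra_simps\<close>)

lemma degree_int_prod: "degree (int_prod k) \<le> 2 * k"
proof -
  have "degree (int_prod k) \<le> (\<Sum>j=1..k. degree [:1 :: rat, 0, - 1 / of_nat j ^ 2:])"
    unfolding int_prod_def using degree_prod_sum_le[of "{1..k}" "\<lambda>j. [:1 :: rat, 0, - 1 / of_nat j ^ 2:]"]
    by (simp only: o_def finite_atLeastAtMost)
  also have "\<dots> \<le> (\<Sum>j=1..k. 2)" by (intro sum_mono) simp
  finally show ?thesis by simp
qed

section \<open>The products modulo \<open>p\<close> as polynomials\<close>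

context prime_gt3 begin

lemma central_diff_IP: "f \<in> IP m \<Longrightarrow> central_diff f \<in> IP m"
  unfolding central_diff_def
  by (intro IP_diff IP_pcompose) (auto simp: IP_pCons intro: I_minus)

text \<open>By Fermat \<open>1 - x^(p-1)\<close> is the indicator of 0 modulo \<open>p\<close>, and
  interpolation in degree below \<open>p\<close> is unique.\<close>

lemma delta_poly_cong:
  assumes "f \<in> IP 0" "degree f < p" "poly f 0 = 1" "\<And>m. m \<in> {1..p-1} \<Longrightarrow> poly f (of_nat m) \<in> I 1"
  shows "f - (1 - monom 1 (p - 1)) \<in> IP 1"
proof (rule residue_lagrange[of 0])
  show "f - (1 - monom 1 (p - 1)) \<in> IP 0" using assms by (intro IP_diff IP_monom) auto
  have "degree (1 - monom 1 (p - 1) :: rat poly) < p"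
    using gt3 by (intro le_less_trans[OF degree_diff_le_max]) (auto intro: le_less_trans[OF degree_monom_le])
  then show "degree (f - (1 - monom 1 (p - 1))) < p"
    using assms(2) by (intro le_less_trans[OF degree_diff_le_max]) simp
  fix m assume m: "m < p"
  show "poly (f - (1 - monom 1 (p - 1))) (of_nat m + 0) \<in> I 1"
  proof (cases "m = 0")
    case True
    then show ?thesis using assms(3) gt3 by (simp add: poly_monom zero_power)
  next
    case False
    then have "\<not> p dvd m" using m by (auto dest: dvd_imp_le)
    then have "poly f (of_nat m) + (of_nat m ^ (p - 1) - 1) \<in> I 1"
      using False m by (intro I_add assms(4) fermat) auto
    then show ?thesis by (simp add: poly_monom algebra_simps)
  qed
qed simp

lemma int_prod_half_poly: "int_prod n - (1 - monom 1 (p - 1)) \<in> IP 1"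
proof (rule delta_poly_cong)
  show "degree (int_prod n) < p" using degree_int_prod[of n] p_eq by simp
  show "poly (int_prod n) 0 = 1" by (simp add: int_prod_def poly_prod)
qed (use int_prod_IP[of n] int_prod_half_cong p_eq in auto)

text \<open>\<open>int_prod (p - 1)\<close> has degree \<open>2(p - 1)\<close>, too large for
  interpolation at \<open>p\<close> points; its two halves with factors \<open>1 + x/j\<close> and
  \<open>1 - x/j\<close> are within reach.\<close>

lemma linear_prod_cong:
  assumes s: "s = 1 \<or> s = - 1"
  shows "(\<Prod>j=1..p-1. [:1, s / of_nat j:]) - (1 - monom 1 (p - 1)) \<in> IP 1"
proof (rule delta_poly_cong)
  let ?f = "\<Prod>j=1..p-1. [:1, s / of_nat j:]"
  have s0: "s \<in> I 0" using s I_of_int[of "- 1"] by auto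
  show "?f \<in> IP 0" using s0 by (intro IP_prod) (auto simp: IP_pCons intro!: I_divide unit_small)
  have "degree ?f \<le> (\<Sum>j=1..p-1. degree [:1, s / of_nat j:])"
    using degree_prod_sum_le[of "{1..p-1}" "\<lambda>j. [:1, s / of_nat j:]"]
    by (simp only: o_def finite_atLeastAtMost)
  also have "\<dots> \<le> (\<Sum>j=1..p-1. 1)" by (intro sum_mono) simp
  also have "\<dots> < p" using gt3 by simp
  finally show "degree ?f < p" .
  show "poly ?f 0 = 1" by (simp add: poly_prod)
  fix m assume m: "m \<in> {1..p-1}"
  \<comment> \<open>The factor at \<open>j = i\<close> vanishes modulo \<open>p\<close>: it is
    \<open>p/(p - m)\<close> or 0.\<close>
  define i where "i = (if s = 1 then p - m else m)"
  have i: "i \<in> {1..p-1}" using m by (auto simp: i_def)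
  have pm: "of_nat (p - m) = (of_nat p - of_nat m :: rat)" using m by (intro of_nat_diff) auto
  have "poly ?f (of_nat m) = (1 + of_nat m * (s / of_nat i)) * (\<Prod>j\<in>{1..p-1}-{i}. 1 + of_nat m * (s / of_nat j))"
    unfolding poly_prod using prod.remove[OF _ i, of "\<lambda>j. 1 + of_nat m * (s / of_nat j)"] by simp
  also have "\<dots> \<in> I 1"
  proof (rule I_mult0')
    have nz: "(of_nat i :: rat) \<noteq> 0" using i by simp
    have "1 + of_nat m * (s / of_nat i) = (of_nat i + of_nat m * s) / of_nat i"
      using nz by (simp add: field_simps)
    also have "of_nat i + of_nat m * s = (if s = 1 then of_nat p else 0)"
      using s pm by (auto simp: i_def)
    also have "(if s = 1 then of_nat p else 0) / of_nat i \<in> I 1"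
      using i by (intro I_divide unit_small) auto
    finally show "1 + of_nat m * (s / of_nat i) \<in> I 1" .
    show "(\<Prod>j\<in>{1..p-1}-{i}. 1 + of_nat m * (s / of_nat j)) \<in> I 0"
      using s0 by (intro I_prod I_add I_mult0 I_divide unit_small) auto
  qed
  finally show "poly ?f (of_nat m) \<in> I 1" .
qed

lemma int_prod_full_poly: "int_prod (p - 1) - (1 - monom 1 (p - 1)) ^ 2 \<in> IP 1"
proof -
  define A where "A s = (\<Prod>j=1..p-1. [:1, s / of_nat j:])" for s :: rat
  define Y :: "rat poly" where "Y = 1 - monom 1 (p - 1)"
  have "int_prod (p - 1) = A 1 * A (- 1)"
    unfolding A_def int_prod_def prod.distrib[symmetric]
    by (intro prod.cong) (auto simp: power2_eq_square)
  then have "int_prod (p - 1) - Y ^ 2 = (A 1 - Y) * A (- 1) + Y * (A (- 1) - Y)"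
    by (simp add: power2_eq_square algebra_simps)
  moreover have "A 1 - Y \<in> IP 1" "A (- 1) - Y \<in> IP 1"
    unfolding A_def Y_def using linear_prod_cong[of 1] linear_prod_cong[of "- 1"] by simp_all
  moreover have "Y \<in> IP 0" unfolding Y_def by (intro IP_diff IP_monom) auto
  moreover have "A (- 1) \<in> IP 0" unfolding A_def
    by (intro IP_prod) (auto simp: IP_pCons intro!: I_minus I_divide unit_small)
  ultimately show ?thesis unfolding Y_def[symmetric] by (auto intro: IP_mult IP_mult')
qed

text \<open>Among the half-integers \<open>m + 1/2\<close> with \<open>m < p\<close>, the product
  vanishes modulo \<open>p\<close> at all but \<open>m = n\<close>, where the point is
  \<open>p/2\<close> and thus 0 modulo \<open>p\<close>.\<close>

lemma half_prod_cong: "half_prod n - smult (poly (half_prod n) 0) (1 - monom 1 (p - 1)) \<in> IP 1"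
proof (rule residue_lagrange[of "1 / 2"])
  let ?E = "half_prod n"
  let ?c = "poly ?E 0"
  have c: "?c \<in> I 0" by (intro IP_poly half_prod_IP) auto
  show "?E - smult ?c (1 - monom 1 (p - 1)) \<in> IP 0"
    using c by (intro IP_diff IP_smult half_prod_IP IP_monom) auto
  have "degree (1 - monom 1 (p - 1) :: rat poly) < p"
    using gt3 by (intro le_less_trans[OF degree_diff_le_max]) (auto intro: le_less_trans[OF degree_monom_le])
  then show "degree (?E - smult ?c (1 - monom 1 (p - 1))) < p"
    using degree_half_prod[of n] p_eq
    by (intro le_less_trans[OF degree_diff_le_max]) (auto intro: le_less_trans[OF degree_smult_le])
  fix m assume m: "m < p"
  define x where "x = (of_nat m + 1/2 :: rat)"
  have x0: "x \<in> I 0" by (auto simp: x_def)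
  have "poly ?E x - ?c * (1 - x ^ (p - 1)) \<in> I 1"
  proof (cases "m = n")
    case True
    then have x: "x \<in> I 1" using half_p_I(1) by (simp only: x_def half_index)
    have "poly ?E x - ?c \<in> I 1" using x x0 by (intro IP_poly_cong half_prod_IP) auto
    moreover have "?c * x ^ (p - 1) \<in> I 1"
      using c I_mono[OF _ I_power1[OF x, of "p - 1"], of 1] gt3 by (intro I_mult0) auto
    ultimately have "(poly ?E x - ?c) + ?c * x ^ (p - 1) \<in> I 1" by (rule I_add)
    then show ?thesis by (simp add: algebra_simps)
  next
    case False
    \<comment> \<open>For \<open>m < n\<close> factor \<open>i\<close> is exactly 0; for
      \<open>m > n\<close> one has \<open>i - 1/2 = p - x\<close>, and it is
      \<open>p (p - 2x)\<close>.\<close>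
    define i where "i = (if m < n then Suc m else p - m)"
    have i: "i \<in> {1..n}" using m False p_eq by (auto simp: i_def)
    have "poly ?E x = ((of_nat i - 1/2) ^ 2 - x ^ 2) * (\<Prod>j\<in>{1..n}-{i}. (of_nat j - 1/2) ^ 2 - x ^ 2)"
      unfolding half_prod_def poly_prod using prod.remove[OF _ i, of "\<lambda>j. (of_nat j - 1/2) ^ 2 - x ^ 2"]
      by (simp add: power2_eq_square[of x])
    also have "(of_nat i - 1/2) ^ 2 - x ^ 2 = of_nat p * (if m < n then 0 else of_nat p - 2 * of_nat m - 1)"
    proof -
      have "of_nat (p - m) = (of_nat p - of_nat m :: rat)" using m by (intro of_nat_diff) auto
      then show ?thesis by (auto simp: i_def x_def power2_eq_square algebra_simps)
    qed
    also have "of_nat p * (if m < n then 0 else of_nat p - 2 * of_nat m - 1)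
        * (\<Prod>j\<in>{1..n}-{i}. (of_nat j - 1/2) ^ 2 - x ^ 2) \<in> I 1"
      using x0 by (intro I_mult0' I_p I_prod I_diff I_power) (auto intro!: I_diff)
    finally have 1: "poly ?E x \<in> I 1" .
    \<comment> \<open>Needed for Fermat at \<open>x = (2m + 1)/2\<close>; below \<open>2p\<close>
      the only candidate is \<open>p\<close> itself, meaning \<open>m = n\<close>.\<close>
    have "\<not> p dvd 2 * m + 1"
    proof
      assume "p dvd 2 * m + 1"
      then obtain k where "2 * m + 1 = p * k" by (elim dvdE)
      moreover have "2 * m + 1 < p * 2" using m by simp
      ultimately have "k < 2" "k \<noteq> 0" by (metis mult_less_cancel1, metis add_is_0 mult_0_right one_neq_zero)
      then have "k = 1" by simp
      then show False using \<open>2 * m + 1 = p * k\<close> False p_eq by simp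
    qed
    then have "(of_nat (2 * m + 1) ^ (p - 1) - 1) - (of_nat 2 ^ (p - 1) - 1) \<in> I 1"
      using p_not_dvd_2 by (intro I_diff fermat)
    then have "(of_nat (2 * m + 1) ^ (p - 1) - 2 ^ (p - 1)) / 2 ^ (p - 1) \<in> I 1"
      by (intro I_divide unit_power unit_2) simp
    also have "(of_nat (2 * m + 1) ^ (p - 1) - 2 ^ (p - 1)) / 2 ^ (p - 1) = x ^ (p - 1) - 1"
    proof -
      have "of_nat (2 * m + 1) = 2 * x" by (simp add: x_def)
      then show ?thesis by (simp add: power_mult_distrib field_simps)
    qed
    finally have "poly ?E x + ?c * (x ^ (p - 1) - 1) \<in> I 1" using 1 c by (intro I_add I_mult0)
    then show ?thesis by (simp add: algebra_simps)
  qed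
  then show "poly (?E - smult ?c (1 - monom 1 (p - 1))) (of_nat m + 1 / 2) \<in> I 1"
    by (simp add: poly_monom x_def)
qed simp

text \<open>Each coefficient of \<open>w\<close> is congruent to the one \<open>b\<close> places
  lower, or to 0 at the bottom.\<close>

lemma monom_mult_cancel:
  assumes "monom 1 a * (monom 1 b - 1) * w \<in> IP 1" "b \<ge> 1"
  shows "w \<in> IP 1"
proof -
  have *: "(if i < b then 0 else coeff w (i - b)) - coeff w i \<in> I 1" for i
  proof -
    have "coeff (monom 1 a * (monom 1 b - 1) * w) (a + i) = (if i < b then 0 else coeff w (i - b)) - coeff w i"
      by (simp add: mult.assoc coeff_monom_mult left_diff_distrib)
    then show ?thesis using IP_coeff[OF assms(1), of "a + i"] by simp
  qed
  have "coeff w i \<in> I 1" for i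
  proof (induction i rule: less_induct)
    case (less i)
    have "(if i < b then 0 else coeff w (i - b)) \<in> I 1" using less assms(2) by auto
    from I_diff[OF this *[of i]] show ?case by simp
  qed
  then show ?thesis by (simp add: IP_def)
qed

text \<open>The middle binomial coefficients are divisible by \<open>p\<close>, so
  \<open>(x + a)^p\<close> reduces to \<open>x^p + a^p\<close>, and \<open>a^p\<close> to
  \<open>x\<close>-free \<open>a\<close>.\<close>

lemma artin_schreier_shift:
  assumes "a \<in> I 0" "a ^ p - a \<in> I 1"
  shows "pcompose (monom 1 p - monom 1 1) [:a, 1:] - (monom 1 p - monom 1 1) \<in> IP 1"
proof -
  define x :: "rat poly" where "x = monom 1 1"
  have x: "x \<in> IP 0" unfolding x_def by (intro IP_monom) auto
  have xk: "monom 1 k = x ^ k" for k by (simp add: x_def monom_power)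
  have s: "[:a, 1:] = x + [:a:]" by (simp add: x_def monom_altdef)
  have pc: "pcompose x s = s" for s :: "rat poly" by (simp add: x_def monom_altdef pcompose_pCons)
  have pcp: "pcompose (x ^ k) s = s ^ k" for s k
    by (induction k) (simp_all add: pcompose_mult pc pcompose_1)
  have "(x + [:a:]) ^ p = (\<Sum>k\<le>p. of_nat (p choose k) * x ^ k * [:a:] ^ (p - k))"
    by (rule binomial_ring)
  also have "{..p} = insert 0 (insert p {1..p-1})" using gt3 by auto
  finally have expand: "(x + [:a:]) ^ p = [:a:] ^ p + x ^ p + (\<Sum>k=1..p-1. of_nat (p choose k) * x ^ k * [:a:] ^ (p - k))"
    using gt3 by simp
  have middle: "(\<Sum>k=1..p-1. of_nat (p choose k) * x ^ k * [:a:] ^ (p - k)) \<in> IP 1"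
  proof (rule IP_sum)
    fix k assume "k \<in> {1..p-1}"
    then have "p dvd (p choose k)" using prime gt3 by (intro dvd_choose_prime) auto
    then obtain c where "p choose k = p * c" by (elim dvdE)
    then have "of_nat (p choose k) \<in> I 1" using I_mult0'[OF I_p(1), of "of_nat c"] by simp
    then have "of_nat (p choose k) \<in> IP 1" by (simp add: of_nat_poly IP_pCons)
    moreover have "x ^ k \<in> IP 0" by (simp flip: xk) (simp add: IP_monom)
    moreover have "[:a:] ^ (p - k) \<in> IP 0" using assms(1) by (simp add: poly_const_pow IP_pCons I_power)
    ultimately show "of_nat (p choose k) * x ^ k * [:a:] ^ (p - k) \<in> IP 1"
      by (intro IP_mult')
  qed
  have const: "[:a:] ^ p - [:a:] \<in> IP 1" using assms(2) by (simp add: poly_const_pow IP_pCons)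
  have "pcompose (monom 1 p - monom 1 1) [:a, 1:] - (monom 1 p - monom 1 1)
     = (x + [:a:]) ^ p - x ^ p - [:a:]"
    unfolding pcompose_diff xk pcp s by simp
  also have "\<dots> = ([:a:] ^ p - [:a:]) + (\<Sum>k=1..p-1. of_nat (p choose k) * x ^ k * [:a:] ^ (p - k))"
    unfolding expand by simp
  finally show ?thesis using IP_add[OF const middle] by (simp only:)
qed

lemma half_fermat: "(1/2) ^ p - 1/2 \<in> I 1" "(- 1/2) ^ p - (- 1/2) \<in> I 1"
proof -
  have "- (of_nat 2 ^ (p - 1) - 1) / 2 ^ p \<in> I 1" by (intro I_divide I_minus fermat p_not_dvd_2 unit_power unit_2)
  also have "- (of_nat 2 ^ (p - 1) - 1) / 2 ^ p = (1/2) ^ p - (1/2 :: rat)"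
    using gt3 by (cases p) (auto simp: field_simps)
  finally show 1: "(1/2) ^ p - 1/2 \<in> I 1" .
  have "odd p" using p_eq by simp
  then have "(- 1/2) ^ p - (- 1/2) = - ((1/2) ^ p - (1/2 :: rat))"
    by (simp add: power_divide)
  then show "(- 1/2) ^ p - (- 1/2) \<in> I 1" using I_minus[OF 1] by (simp only:)
qed

end

lemma bernoulli_0: "bernoulli 0 = 1"
proof -
  have "fps_nth (bernoulli_gf * (fps_exp 1 - 1)) 1 = fps_nth (fps_X :: rat fps) 1"
    by (simp only: bernoulli_gf_mult)
  then show ?thesis by (simp add: bernoulli_def fps_mult_nth)
qed

section \<open>Assembly of the upper half and of the full sum\<close>

context prime_gt3 begin

lemma upper_half_sum: "poly (harm_poly (p - 1)) 0 - poly (harm_poly n) 0 - 31/2 * of_nat p ^ 2 * bernoulli (p - 5) \<in> I 3"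
proof -
  define E where "E = half_prod n"
  define e where "e = poly E 0"
  define T :: "rat poly" where "T = [:(of_nat p / 2) ^ 2, 0, -1:]"
  \<comment> \<open>All terms with \<open>k > n\<close> contain the factors
    \<open>j \<le> n\<close>, collected in \<open>E\<close>, and \<open>j = n + 1\<close>, which is
    \<open>T\<close>; \<open>R\<close> is what remains.\<close>
  define R where "R = (\<Sum>k=n+1..p-1. smult (weight k) (\<Prod>j=n+2..k. [:(of_nat j - 1/2) ^ 2, 0, -1:]))"
  define g where "g = harm_poly (p - 1) - harm_poly n"
  define X :: "rat poly" where "X = monom 1 1"
  define Y where "Y = X ^ (p - 1)"
  define L where "L = X ^ p - X"
  define V where "V = X * R"
  have mon: "monom 1 k = X ^ k" for k by (simp add: X_def monom_power)
  have X0: "X ^ k \<in> IP 0" for k by (simp flip: mon) (simp add: IP_monom)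
  have E0: "E \<in> IP 0" unfolding E_def by (rule half_prod_IP)
  have e0: "e \<in> I 0" unfolding e_def by (intro IP_poly E0) auto
  have R0: "R \<in> IP 0" unfolding R_def
    by (intro IP_sum IP_smult weight_I IP_prod) (auto simp: IP_pCons intro!: I_power I_minus)
  have V0: "V \<in> IP 0" unfolding V_def using IP_mult[OF X0[of 1] R0] by simp
  have Y0: "Y \<in> IP 0" unfolding Y_def by (rule X0)
  have L0: "L \<in> IP 0" unfolding L_def using IP_diff[OF X0[of p] X0[of 1]] by simp

  have g: "g = E * T * R"
  proof -
    have "harm_poly (p - 1) = harm_poly n + (\<Sum>k=n+1..p-1. smult (weight k) (half_prod k))"
    proof -
      have "{1..p-1} = {1..n} \<union> {n+1..p-1}" using p_eq by auto
      then show ?thesis unfolding harm_poly_def by (simp add: sum.union_disjoint)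
    qed
    moreover have "half_prod k = E * T * (\<Prod>j=n+2..k. [:(of_nat j - 1/2) ^ 2, 0, -1:])" if "k \<in> {n+1..p-1}" for k
    proof -
      have "{1..k} = {1..n} \<union> insert (n + 1) {n+2..k}" using that by auto
      then have "half_prod k = half_prod n * (\<Prod>j\<in>insert (n + 1) {n+2..k}. [:(of_nat j - 1/2) ^ 2, 0, -1:])"
        unfolding half_prod_def by (simp only:) (rule prod.union_disjoint, auto)
      also have "(\<Prod>j\<in>insert (n + 1) {n+2..k}. [:(of_nat j - 1/2) ^ 2 :: rat, 0, -1:]) = T * (\<Prod>j=n+2..k. [:(of_nat j - 1/2) ^ 2, 0, -1:])"
      proof -
        have "of_nat (n + 1) - 1/2 = (of_nat p / 2 :: rat)" using half_index by simp
        then show ?thesis unfolding T_def by (subst prod.insert) (simp_all only: finite_atLeastAtMost, simp)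
      qed
      finally show ?thesis by (simp add: E_def mult.assoc)
    qed
    ultimately show ?thesis
      unfolding g_def R_def sum_distrib_left by (auto simp: intro!: sum.cong)
  qed

  \<comment> \<open>Modulo \<open>p\<close> the \<open>gharm 2\<close> terms vanish, and the two
    integer products become \<open>(1 - Y)^2\<close> and \<open>1 - Y\<close>.\<close>
  have diff_g: "X ^ 3 * central_diff g - 2 * (Y ^ 2 - Y) \<in> IP 1"
  proof -
    let ?Pn = "int_prod n" and ?Pf = "int_prod (p - 1)"
    have n: "n < p" "p - 1 < p" using p_eq by auto
    have "X ^ 3 * central_diff g - 2 * (Y ^ 2 - Y) = smult 2 (
       smult (gharm 2 (p - 1)) (X ^ 2 * ?Pf) - smult (gharm 2 n) (X ^ 2 * ?Pn)
       + (?Pf - (1 - Y) ^ 2) - (?Pn - (1 - Y)))"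
      using central_diff_harm_poly[of n] central_diff_harm_poly[of "p - 1"]
      unfolding g_def central_diff_diff mon
      by (simp add: right_diff_distrib smult_diff_right smult_add_right power2_eq_square algebra_simps numeral_poly)
    also have "\<dots> \<in> IP 1"
    proof -
      have "?Pf - (1 - Y) ^ 2 \<in> IP 1" "?Pn - (1 - Y) \<in> IP 1"
        using int_prod_full_poly int_prod_half_poly by (simp_all add: Y_def mon)
      moreover have "smult (gharm 2 (p - 1)) (X ^ 2 * ?Pf) \<in> IP 1" "smult (gharm 2 n) (X ^ 2 * ?Pn) \<in> IP 1"
        by (intro IP_smult' gharm2_full gharm2_half IP_mult X0 int_prod_IP n)+
      ultimately show ?thesis by (intro IP_smult[OF _ IP_diff[OF IP_add[OF IP_diff]]]) auto
    qed
    finally show ?thesis .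
  qed

  have T: "T + X ^ 2 \<in> IP 1"
  proof -
    have "T + X ^ 2 = [:(of_nat p / 2) ^ 2:]" unfolding T_def X_def
      by (simp add: monom_altdef power2_eq_square)
    then show ?thesis using I_mono[OF _ I_power1[OF half_p_I(1), of 2], of 1] by (simp add: IP_pCons)
  qed
  have EY: "E - smult e (1 - Y) \<in> IP 1"
    using half_prod_cong by (simp add: E_def e_def Y_def mon)
  have XY: "X * Y = X ^ p" using gt3 by (cases p) (simp_all add: Y_def)
  \<comment> \<open>Here \<open>T\<close> reduces to \<open>-X^2\<close> and \<open>E\<close> to
    \<open>e (1 - Y)\<close>, while \<open>X (Y - 1) = L\<close>.\<close>
  have g_cong: "g - smult e (L * V) \<in> IP 1"
  proof -
    have "g - smult e (L * V) = (T + X ^ 2) * (E * R) - (E - smult e (1 - Y)) * (X ^ 2 * R)"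
      unfolding g L_def V_def XY[symmetric]
      by (simp add: algebra_simps power2_eq_square smult_diff_right)
    also have "\<dots> \<in> IP 1"
      by (intro IP_diff IP_mult' T EY) (intro IP_mult E0 R0 X0)+
    finally show ?thesis .
  qed
  have neg_half: "- 1/2 \<in> I 0" using I_minus[OF half_I] by simp
  have shift: "pcompose L [:a, 1:] - L \<in> IP 1" if "a = 1/2 \<or> a = - 1/2" for a
  proof -
    have "a \<in> I 0" using that half_I neg_half by blast
    moreover have "a ^ p - a \<in> I 1" using that half_fermat by blast
    moreover have "L = monom 1 p - monom 1 1" by (simp only: L_def mon power_one_right)
    ultimately show ?thesis using artin_schreier_shift by simp
  qed
  have s: "pcompose V [:a, 1:] \<in> IP 0" if "a = 1/2 \<or> a = - 1/2" for a
  proof -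
    have "a \<in> I 0" using that half_I neg_half by blast
    then show ?thesis by (intro IP_pcompose V0) (simp add: IP_pCons)
  qed
  \<comment> \<open>Shift invariance pulls \<open>L\<close> out of the central difference modulo
    \<open>p\<close>.\<close>
  have "central_diff (smult e (L * V)) - smult e (L * central_diff V)
     = smult e ((pcompose L [:1/2, 1:] - L) * pcompose V [:1/2, 1:]
       - (pcompose L [:- 1/2, 1:] - L) * pcompose V [:- 1/2, 1:])"
    unfolding central_diff_def by (simp add: pcompose_smult pcompose_mult algebra_simps smult_diff_right smult_add_right)
  also have "\<dots> \<in> IP 1"
    by (intro IP_smult e0 IP_diff IP_mult' shift s) auto
  finally have diff_LV: "central_diff (smult e (L * V)) - smult e (L * central_diff V) \<in> IP 1" .

  \<comment> \<open>Since \<open>Y^2 - Y = X^3 L X^(p-5)\<close>, the product \<open>X^3 L W\<close>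
    is 0 modulo \<open>p\<close>, and \<open>X^3 L\<close> cancels.\<close>
  define W where "W = smult e (central_diff V) - 2 * X ^ (p - 5)"
  have "W \<in> IP 1"
  proof (rule monom_mult_cancel)
    have p1: "p - 1 = (p - 5) + 4" using p_ge_5 by simp
    have YL: "Y ^ 2 - Y = X ^ 3 * L * X ^ (p - 5)"
      unfolding L_def XY[symmetric] Y_def p1 power_add
      by (simp add: algebra_simps power2_eq_square power3_eq_cube power4_eq_xxxx)
    have "X ^ 3 * L * W = X ^ 3 * central_diff g - 2 * (Y ^ 2 - Y)
      - X ^ 3 * central_diff (g - smult e (L * V))
      - X ^ 3 * (central_diff (smult e (L * V)) - smult e (L * central_diff V))"
      unfolding W_def YL central_diff_diff by (simp add: algebra_simps smult_diff_right smult_add_right)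
    also have "\<dots> \<in> IP 1"
      by (intro IP_diff[OF IP_diff] diff_g IP_mult X0 central_diff_IP g_cong diff_LV)
    also have "X ^ 3 * L = monom 1 4 * (monom 1 (p - 1) - 1)"
      unfolding mon L_def XY[symmetric] Y_def
      by (simp add: algebra_simps power3_eq_cube power4_eq_xxxx)
    finally show "monom 1 4 * (monom 1 (p - 1) - 1) * W \<in> IP 1" .
  qed (use gt3 in simp)

  define m where "m = p - 5"
  have m: "Suc m < p" "Suc m \<le> p - 2" using p_ge_5 by (auto simp: m_def)
  have um: "unit (of_nat (Suc m))" using m by (intro unit_small) auto
  \<comment> \<open>\<open>B\<close> has central difference \<open>2 x^(p-5)\<close>, so
    \<open>e V - B\<close> is constant modulo \<open>p\<close>. The linear coefficient of
    \<open>V = X R\<close> is \<open>R(0)\<close>, that of \<open>B\<close> reduces to 62 times the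
    Bernoulli number.\<close>
  define B where "B = smult (2 / of_nat (Suc m)) (central_bernpoly (Suc m))"
  have "coeff (smult e V - B) 1 \<in> I 1"
  proof (rule periodic_coeff)
    show "smult e V - B \<in> IP 0" unfolding B_def using um m
      by (intro IP_diff IP_smult e0 V0 central_bernpoly_IP I_divide) auto
    have "degree (\<Prod>j=n+2..k. [:(of_nat j - 1/2) ^ 2 :: rat, 0, -1:]) \<le> p - 3" if "k \<le> p - 1" for k
    proof -
      have "degree (\<Prod>j=n+2..k. [:(of_nat j - 1/2) ^ 2 :: rat, 0, -1:]) \<le> (\<Sum>j=n+2..k. degree [:(of_nat j - 1/2) ^ 2 :: rat, 0, -1:])"
        using degree_prod_sum_le[of "{n+2..k}" "\<lambda>j. [:(of_nat j - 1/2) ^ 2 :: rat, 0, -1:]"]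
        by (simp only: o_def finite_atLeastAtMost)
      also have "\<dots> \<le> p - 3" using that p_eq by simp
      finally show ?thesis .
    qed
    then have "degree R \<le> p - 3" unfolding R_def
      by (intro degree_sum_le) (auto intro!: order_trans[OF degree_smult_le])
    then have "degree V < p" unfolding V_def X_def using gt3
      by (intro le_less_trans[OF degree_mult_le]) (auto simp: degree_monom_eq)
    moreover have "degree B < p" unfolding B_def using m
      by (intro le_less_trans[OF degree_smult_le] le_less_trans[OF degree_central_bernpoly])
    ultimately show "degree (smult e V - B) < p"
      by (intro le_less_trans[OF degree_diff_le_max]) (auto intro: le_less_trans[OF degree_smult_le])
    fix k assume "k \<in> {1..p-1}"
    define x where "x = (of_nat k :: rat)"
    have "poly B (x + 1/2) - poly B (x - 1/2) = 2 / of_nat (Suc m) *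
       (poly (central_bernpoly (Suc m)) (x + 1/2) - poly (central_bernpoly (Suc m)) (x - 1/2))"
      unfolding B_def by (simp add: algebra_simps)
    also have "\<dots> = 2 * x ^ m" unfolding central_bernpoly_diff by simp
    also have "\<dots> = poly (2 * X ^ (p - 5)) x" by (simp add: m_def X_def poly_monom)
    finally have "poly (smult e V - B) (x + 1/2) - poly (smult e V - B) (x - 1/2) = poly W x"
      unfolding W_def by (simp add: poly_central_diff algebra_simps)
    moreover have "poly W x \<in> I 1" using \<open>W \<in> IP 1\<close> by (intro IP_poly) (auto simp: x_def)
    ultimately show "poly (smult e V - B) (of_nat k + 1/2) - poly (smult e V - B) (of_nat k - 1/2) \<in> I 1"
      by (simp only: x_def)
  qed simp
  moreover have "coeff B 1 = 2 * (fact (p - 5) * fps_nth central_gf (p - 5))"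
    unfolding B_def by (simp add: coeff_central_bernpoly m_def del: of_nat_Suc)
  moreover have "coeff V 1 = poly R 0"
    unfolding V_def X_def by (simp add: coeff_monom_mult poly_0_coeff_0)
  ultimately have "(e * poly R 0 - 2 * (fact (p - 5) * fps_nth central_gf (p - 5)))
      + 2 * (fact (p - 5) * fps_nth central_gf (p - 5) - 31 * bernoulli (p - 5)) \<in> I 1"
    by (intro I_add I_mult0 central_gf_cong) auto
  then have "e * poly R 0 - 62 * bernoulli (p - 5) \<in> I 1" by (simp add: algebra_simps)
  from I_mult[OF I_power1[OF half_p_I(1), of 2] this]
  have "(of_nat p / 2) ^ 2 * (e * poly R 0 - 62 * bernoulli (p - 5)) \<in> I 3" by (simp add: numeral_3_eq_3)
  also have "(of_nat p / 2) ^ 2 * (e * poly R 0 - 62 * bernoulli (p - 5))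
      = poly g 0 - 31/2 * of_nat p ^ 2 * bernoulli (p - 5)"
    unfolding g by (simp add: e_def T_def power_divide algebra_simps)
  finally show ?thesis by (simp add: g_def)
qed

text \<open>The Bernoulli coefficients add up as
  \<open>31/2 - 31 + 2 * 81/10 = 7/10\<close>.\<close>

lemma full_sum:
  assumes "p > 5"
  shows "poly (harm_poly (p - 1)) 0 - (- 12 * gharm 1 (p - 1) / of_nat p ^ 2 + 7/10 * of_nat p ^ 2 * bernoulli (p - 5)) \<in> I 3"
    (is "?l \<in> _")
proof -
  have "?l = (poly (harm_poly (p - 1)) 0 - poly (harm_poly n) 0 - 31/2 * of_nat p ^ 2 * bernoulli (p - 5))
     + (poly (harm_poly n) 0 - (- 2 * gharm 3 n - 31 * of_nat p ^ 2 * bernoulli (p - 5)))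
     - 2 * (gharm 3 n - 6 * gharm 1 (p - 1) / of_nat p ^ 2 + 81/10 * of_nat p ^ 2 * bernoulli (p - 5))"
    by (simp add: algebra_simps)
  also have "\<dots> \<in> I 3"
    by (rule I_diff[OF I_add[OF upper_half_sum harm_poly_half_zero] I_mult0[OF _ gharm3_half[OF assms]]]) simp
  finally show ?thesis .
qed

end

lemma full_sum_5: "padic_cong 5 3
   (\<Sum>k=1..5-1. gharm 2 k / (of_nat k * 16 ^ k) * of_nat ((2*k) choose k) ^ 2)
   (-12 * gharm 1 (5-1) / of_nat 5 ^ 2 + 7/10 * of_nat 5 ^ 2 * bernoulli (5-5))"
proof -
  have "{1..5-1} = {1, 2, 3, 4 :: nat}" by auto
  moreover have "gharm r 1 = 1" "gharm r 2 = 1 + 1 / 2 ^ r" "gharm r 3 = 1 + 1 / 2 ^ r + 1 / 3 ^ r"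
    "gharm r 4 = 1 + 1 / 2 ^ r + 1 / 3 ^ r + 1 / 4 ^ r" for r
    by (simp_all add: gharm_def numeral_eq_Suc)
  moreover have "((2 * 1) choose 1 :: nat) = 2" "((2 * 2) choose 2 :: nat) = 6"
    "((2 * 3) choose 3 :: nat) = 20" "((2 * 4) choose 4 :: nat) = 70"
    by (simp_all add: numeral_eq_Suc)
  \<comment> \<open>The witnesses are the exact difference divided by \<open>5^3\<close>; its
    denominator \<open>2^20 * 3^3\<close> is prime to 5.\<close>
  ultimately show ?thesis
    unfolding padic_cong_def
    by (intro exI[of _ "(-3644533) :: int"] exI[of _ "28311552 :: int"]) (simp add: bernoulli_0)
qed

theorem theorem1p1:
  fixes p :: nat
  assumes "prime p" and "p > 3"
  shows "padic_cong p 3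
           (\<Sum>k=1..p-1. gharm 2 k / (of_nat k * 16 ^ k) * of_nat ((2*k) choose k) ^ 2)
           (-12 * gharm 1 (p-1) / of_nat p ^ 2 + 7/10 * of_nat p ^ 2 * bernoulli (p-5))
       \<and> padic_cong p 3
           (\<Sum>k=(p+1) div 2..p-1. gharm 2 k / (of_nat k * 16 ^ k) * of_nat ((2*k) choose k) ^ 2)
           (31/2 * of_nat p ^ 2 * bernoulli (p-5))"
proof -
  define n where "n = p div 2"
  have "odd p" using assms prime_odd_nat by auto
  then have p_eq: "p = 2 * n + 1" by (simp add: n_def)
  interpret prime_gt3 p n using assms p_eq by unfold_locales
  have total: "(\<Sum>k=1..K. gharm 2 k / (of_nat k * 16 ^ k) * of_nat ((2*k) choose k) ^ 2) = poly (harm_poly K) 0" for K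
    unfolding harm_poly_def poly_sum poly_smult weight_half_prod ..
  have "(\<Sum>k=(p+1) div 2..p-1. gharm 2 k / (of_nat k * 16 ^ k) * of_nat ((2*k) choose k) ^ 2)
      = poly (harm_poly (p - 1)) 0 - poly (harm_poly n) 0"
  proof -
    have "{1..p-1} = {1..n} \<union> {(p+1) div 2..p-1}" "{1..n} \<inter> {(p+1) div 2..p-1} = {}" using p_eq by auto
    then show ?thesis unfolding total[symmetric] by (simp add: sum.union_disjoint)
  qed
  then have "padic_cong p 3
           (\<Sum>k=(p+1) div 2..p-1. gharm 2 k / (of_nat k * 16 ^ k) * of_nat ((2*k) choose k) ^ 2)
           (31/2 * of_nat p ^ 2 * bernoulli (p-5))"
    unfolding padic_cong_iff using upper_half_sum by (simp only:)
  moreover have "padic_cong p 3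
           (\<Sum>k=1..p-1. gharm 2 k / (of_nat k * 16 ^ k) * of_nat ((2*k) choose k) ^ 2)
           (-12 * gharm 1 (p-1) / of_nat p ^ 2 + 7/10 * of_nat p ^ 2 * bernoulli (p-5))"
  proof (cases "p = 5")
    case True
    show ?thesis unfolding True by (rule full_sum_5)
  next
    case False
    then have "p > 5" using p_ge_5 by simp
    then show ?thesis unfolding padic_cong_iff total by (rule full_sum)
  qed
  ultimately show ?thesis by blast
qed

end
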